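(* Let $G_1,G_2$ be topological groups, let $\mathcal H$ be a Hilbert space and let $\rho\colon G_1\times G_2\to \mathcal U(\mathcal H)$ be a continuous unitary representation of the direct product. Then $$\bar H_c^1(G_1\times G_2,\mathcal H)\cong \bar H_c^1(G_1,\mathcal H^{G_2})\oplus \bar H_c^1(G_2,\mathcal H^{G_1}).$$ In particular, if $\mathcal H^{G_1}=\mathcal H^{G_2}=\{0\}$ and $\alpha$ is a continuous affine isometric action of $G_1\times G_2$ on $\mathcal H$ with linear part $\rho$, then $\alpha$ almost fixes a point on $\mathcal H$.
   Context: A unitary representation $\rho$ is continuous if for every $v\in\mathcal H$ the map $g\mapsto\rho(g)v$ is norm continuous. $G_1$ and $G_2$ are identified with the subgroups $G_1\times\{e\}$ and $\{e\}\times G_2$ of $G_1\times G_2$; $\mathcal H^{G_i}$ is the closed subspace of vectors fixed by $\rho(G_i)$. Since $G_1$ and $G_2$ commute, $\mathcal H^{G_2}$ is a $G_1$-module and $\mathcal H^{G_1}$ is a $G_2$-module by restriction. The symbol $\cong$ denotes isomorphism of vector spaces. Reduced continuous cohomology: for a topological group $G$ and a continuous Banach $G$-module $V$ (a Banach space with a linear representation $\rho\colon G\to GL(V)$ by invertible bounded operators such that all maps $g\mapsto\rho(g)v$ are norm continuous), let $C(G^{n+1},V)$ be the space of continuous maps $G^{n+1}\to V$ (norm topology on $V$), with the compact-open topology, and let $C(G^{n+1},V)^G$ be the subspace of $G$-equivariant maps, i.e. $c(gg_0,\dots,gg_n)=\rho(g)c(g_0,\dots,g_n)$. The differential $\partial\colon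 C(G^{n},V)^G\to C(G^{n+1},V)^G$ is $(\partial c)(g_0,\dots,g_n)=\sum_{k=0}^n(-1)^k c(g_0,\dots,\widehat{g_k},\dots,g_n)$; the complex $C(G^{*+1},V)^G$ starts in degree $0$ with $C(G,V)^G$. Let $Z^n(G,V)\subset C(G^{n+1},V)^G$ be the kernel of $\partial$ and $B^n(G,V)\subset C(G^{n+1},V)^G$ the image of $\partial$. Then $\bar H_c^n(G,V)=Z^n(G,V)/\overline{B^n(G,V)}$, the closure being in the compact-open topology. An affine isometric action $\alpha$ of $G$ on $\mathcal H$ with linear part $\rho$ is an action of the form $\alpha(g)v=\rho(g)v+b(g)$ with $b\colon G\to\mathcal H$; it is continuous if $g\mapsto\alpha(g)v$ is norm continuous for every $v$. It almost fixes a point on $\mathcal H$ if for every compact $K\subseteq G$ and every $\epsilon>0$ there is $v\in\mathcal H$ with $\|\alpha(g)v-v\|<\epsilon$ for all $g\in K$. *)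

theory Defs
  imports "HOL-Analysis.Analysis" "HOL-Algebra.Module" "HOL-Algebra.AbelCoset"
begin

class complex_normed_vector = real_normed_vector +
  fixes scaleC :: "complex \<Rightarrow> 'a \<Rightarrow> 'a"  (infixr "*\<^sub>C" 75)
  assumes scaleC_add_right: "a *\<^sub>C (x + y) = a *\<^sub>C x + a *\<^sub>C y"
    and scaleC_add_left: "(a + b) *\<^sub>C x = a *\<^sub>C x + b *\<^sub>C x"
    and scaleC_scaleC: "a *\<^sub>C b *\<^sub>C x = (a * b) *\<^sub>C x"
    and scaleC_complex_of_real: "complex_of_real r *\<^sub>C x = r *\<^sub>R x"
    and norm_scaleC: "norm (a *\<^sub>C x) = cmod a * norm x"

text \<open>
  The complex inner product is conjugate-linear in its first argument. Its real part is the
  inner product of the underlying real Hilbert space, so that the norm coming from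
  class \<open>real_inner\<close> satisfies \<open>(norm x)\<^sup>2 = Re (cinner x x)\<close>; the number \<open>cinner x x\<close> is
  real by \<open>cinner_commute\<close>.
\<close>

class complex_hilbert_space = complex_normed_vector + real_inner + complete_space +
  fixes cinner :: "'a \<Rightarrow> 'a \<Rightarrow> complex"
  assumes cinner_commute: "cinner x y = cnj (cinner y x)"
    and cinner_add_left: "cinner (x + y) z = cinner x z + cinner y z"
    and cinner_scaleC_left: "cinner (a *\<^sub>C x) y = cnj a * cinner x y"
    and Re_cinner: "Re (cinner x y) = inner x y"

instantiation complex :: complex_hilbert_space
begin

definition scaleC_complex :: "complex \<Rightarrow> complex \<Rightarrow> complex"
  where "scaleC_complex a x = a * x"

definition cinner_complex :: "complex \<Rightarrow> complex \<Rightarrow> complex"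
  where "cinner_complex x y = cnj x * y"

instance
  by standard
    (simp_all add: scaleC_complex_def cinner_complex_def inner_complex_def scaleR_conv_of_real
      norm_mult algebra_simps)

end

text \<open>
  Topological groups are the types of class \<open>topological_group_add\<close>. They are written
  additively but are not assumed to be commutative, nor Hausdorff, nor locally compact.
\<close>

instance prod :: (topological_group_add, topological_group_add) topological_group_add
proof
  fix a b :: "'a \<times> 'b"
  have "((\<lambda>x. fst (fst x) + fst (snd x)) \<longlongrightarrow> fst a + fst b) (nhds a \<times>\<^sub>F nhds b)"
    "((\<lambda>x. snd (fst x) + snd (snd x)) \<longlongrightarrow> snd a + snd b) (nhds a \<times>\<^sub>F nhds b)"
    by (intro tendsto_add tendsto_fst tendsto_snd filterlim_fst filterlim_snd)+
  from tendsto_Pair[OF this]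
  show "((\<lambda>x. fst x + snd x) \<longlongrightarrow> a + b) (nhds a \<times>\<^sub>F nhds b)"
    by (simp add: plus_prod_def)
  have "((\<lambda>x. - fst x) \<longlongrightarrow> - fst a) (nhds a)" "((\<lambda>x. - snd x) \<longlongrightarrow> - snd a) (nhds a)"
    by (intro tendsto_minus tendsto_fst tendsto_snd tendsto_ident_at filterlim_ident)+
  from tendsto_Pair[OF this]
  show "(uminus \<longlongrightarrow> - a) (nhds a)"
    by (simp add: uminus_prod_def[abs_def])
qed

definition unitary :: "('h::complex_hilbert_space \<Rightarrow> 'h) \<Rightarrow> bool" where
  "unitary U \<longleftrightarrow>
     (\<forall>x y. U (x + y) = U x + U y) \<and> (\<forall>a x. U (a *\<^sub>C x) = a *\<^sub>C U x) \<and>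
     (\<forall>x y. cinner (U x) (U y) = cinner x y) \<and> surj U"

definition continuous_unitary_rep ::
    "('g::topological_group_add \<Rightarrow> 'h::complex_hilbert_space \<Rightarrow> 'h) \<Rightarrow> bool" where
  "continuous_unitary_rep \<rho> \<longleftrightarrow>
     (\<forall>g. unitary (\<rho> g)) \<and> (\<forall>g h. \<rho> (g + h) = \<rho> g \<circ> \<rho> h) \<and>
     (\<forall>v. continuous_on UNIV (\<lambda>g. \<rho> g v))"

definition fixed_vectors :: "('g \<Rightarrow> 'v \<Rightarrow> 'v) \<Rightarrow> 'v set" where
  "fixed_vectors \<rho> = {v. \<forall>g. \<rho> g v = v}"

text \<open>
  Vector spaces with explicit carriers are records of type \<open>module\<close>; the fields
  \<open>mult\<close> and \<open>one\<close>, which such records inherit from rings, play no role.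
\<close>

definition quotient_space :: "('a, 'b) module \<Rightarrow> 'b set \<Rightarrow> ('a, 'b set) module" where
  "quotient_space M N =
     \<lparr>carrier = a_rcosets\<^bsub>M\<^esub> N, mult = undefined, one = undefined,
      zero = N, add = (\<lambda>X Y. X <+>\<^bsub>M\<^esub> Y),
      smult = (\<lambda>a X. \<Union>x\<in>X. N +>\<^bsub>M\<^esub> (a \<odot>\<^bsub>M\<^esub> x))\<rparr>"

definition direct_sum :: "('a, 'b) module \<Rightarrow> ('a, 'c) module \<Rightarrow> ('a, 'b \<times> 'c) module" where
  "direct_sum M N =
     \<lparr>carrier = carrier M \<times> carrier N, mult = undefined, one = undefined,
      zero = (\<zero>\<^bsub>M\<^esub>, \<zero>\<^bsub>N\<^esub>),
      add = (\<lambda>(x, y) (x', y'). (x \<oplus>\<^bsub>M\<^esub> x', y \<oplus>\<^bsub>N\<^esub> y')),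
      smult = (\<lambda>a (x, y). (a \<odot>\<^bsub>M\<^esub> x, a \<odot>\<^bsub>N\<^esub> y))\<rparr>"

definition isomorphic_spaces :: "(complex, 'b) module \<Rightarrow> (complex, 'c) module \<Rightarrow> bool" where
  "isomorphic_spaces M N \<longleftrightarrow>
     (\<exists>\<phi>. bij_betw \<phi> (carrier M) (carrier N) \<and>
          (\<forall>x\<in>carrier M. \<forall>y\<in>carrier M. \<phi> (x \<oplus>\<^bsub>M\<^esub> y) = \<phi> x \<oplus>\<^bsub>N\<^esub> \<phi> y) \<and>
          (\<forall>a. \<forall>x\<in>carrier M. \<phi> (a \<odot>\<^bsub>M\<^esub> x) = a \<odot>\<^bsub>N\<^esub> \<phi> x))"

text \<open>
  Maps on a topological space are total functions that are \<open>undefined\<close> outside \<open>topspace X\<close>,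
  so that equality of maps is equality on the space; this is why the vector space operations
  on cochains below are restricted to the domain.
\<close>

definition continuous_maps :: "'a topology \<Rightarrow> 'b topology \<Rightarrow> ('a \<Rightarrow> 'b) set" where
  "continuous_maps X Y = {f \<in> extensional (topspace X). continuous_map X Y f}"

definition compact_open_topology :: "'a topology \<Rightarrow> 'b topology \<Rightarrow> ('a \<Rightarrow> 'b) topology" where
  "compact_open_topology X Y =
     topology_generated_by
       {{f \<in> continuous_maps X Y. f ` K \<subseteq> U} | K U. compactin X K \<and> openin Y U}"

definition power_top :: "nat \<Rightarrow> (nat \<Rightarrow> 'g::topological_space) topology" where
  "power_top m = product_topology (\<lambda>_. euclidean) {..<m}"

text \<open>
  In the definitions below \<open>V\<close> is a closed \<open>\<rho>\<close>-invariant subspace, regarded as a module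
  in its own right. The index \<open>n\<close> is the cohomological degree: a cochain of degree \<open>n\<close> takes
  \<open>n + 1\<close> arguments, indexed by \<open>0, \<dots>, n\<close>, and \<open>coboundary n\<close> goes from degree \<open>n\<close> to degree
  \<open>n + 1\<close>. The complex starts in degree 0, so the coboundaries in that degree are zero.
\<close>

definition cochain_space ::
    "('g::topological_group_add \<Rightarrow> 'v::complex_normed_vector \<Rightarrow> 'v) \<Rightarrow> 'v set \<Rightarrow> nat \<Rightarrow>
     (complex, (nat \<Rightarrow> 'g) \<Rightarrow> 'v) module" where
  "cochain_space \<rho> V n = (let X = topspace (power_top (Suc n)) in
     \<lparr>carrier = {c \<in> continuous_maps (power_top (Suc n)) (top_of_set V).
                  \<forall>g. \<forall>x\<in>X. c (\<lambda>i\<in>{..<Suc n}. g + x i) = \<rho> g (c x)},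
      mult = undefined, one = undefined,
      zero = (\<lambda>x\<in>X. 0), add = (\<lambda>c d. \<lambda>x\<in>X. c x + d x),
      smult = (\<lambda>a c. \<lambda>x\<in>X. a *\<^sub>C c x)\<rparr>)"

definition omit_coord :: "nat \<Rightarrow> nat \<Rightarrow> (nat \<Rightarrow> 'g) \<Rightarrow> nat \<Rightarrow> 'g" where
  "omit_coord m k x = (\<lambda>i\<in>{..<m}. if i < k then x i else x (Suc i))"

definition coboundary ::
    "nat \<Rightarrow> ((nat \<Rightarrow> 'g::topological_group_add) \<Rightarrow> 'v::complex_normed_vector) \<Rightarrow> (nat \<Rightarrow> 'g) \<Rightarrow> 'v"
  where
  "coboundary n c =
     (\<lambda>x\<in>topspace (power_top (Suc (Suc n))).
        \<Sum>k\<le>Suc n. (-1) ^ k *\<^sub>R c (omit_coord (Suc n) k x))"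

definition cocycles ::
    "('g::topological_group_add \<Rightarrow> 'v::complex_normed_vector \<Rightarrow> 'v) \<Rightarrow> 'v set \<Rightarrow> nat \<Rightarrow>
     ((nat \<Rightarrow> 'g) \<Rightarrow> 'v) set" where
  "cocycles \<rho> V n =
     {c \<in> carrier (cochain_space \<rho> V n). coboundary n c = \<zero>\<^bsub>cochain_space \<rho> V (Suc n)\<^esub>}"

fun coboundaries ::
    "('g::topological_group_add \<Rightarrow> 'v::complex_normed_vector \<Rightarrow> 'v) \<Rightarrow> 'v set \<Rightarrow> nat \<Rightarrow>
     ((nat \<Rightarrow> 'g) \<Rightarrow> 'v) set" where
  "coboundaries \<rho> V 0 = {\<zero>\<^bsub>cochain_space \<rho> V 0\<^esub>}"
| "coboundaries \<rho> V (Suc n) = coboundary n ` carrier (cochain_space \<rho> V n)"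

definition closed_coboundaries ::
    "('g::topological_group_add \<Rightarrow> 'v::complex_normed_vector \<Rightarrow> 'v) \<Rightarrow> 'v set \<Rightarrow> nat \<Rightarrow>
     ((nat \<Rightarrow> 'g) \<Rightarrow> 'v) set" where
  "closed_coboundaries \<rho> V n =
     subtopology (compact_open_topology (power_top (Suc n)) (top_of_set V))
       (carrier (cochain_space \<rho> V n)) closure_of coboundaries \<rho> V n"

definition reduced_cohomology ::
    "('g::topological_group_add \<Rightarrow> 'v::complex_normed_vector \<Rightarrow> 'v) \<Rightarrow> 'v set \<Rightarrow> nat \<Rightarrow>
     (complex, ((nat \<Rightarrow> 'g) \<Rightarrow> 'v) set) module" where
  "reduced_cohomology \<rho> V n =
     quotient_space ((cochain_space \<rho> V n)\<lparr>carrier := cocycles \<rho> V n\<rparr>)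
       (closed_coboundaries \<rho> V n)"

definition affine_isometric_action ::
    "('g::topological_group_add \<Rightarrow> 'h::complex_hilbert_space \<Rightarrow> 'h) \<Rightarrow> ('g \<Rightarrow> 'h \<Rightarrow> 'h) \<Rightarrow> bool"
  where
  "affine_isometric_action \<rho> \<alpha> \<longleftrightarrow>
     \<alpha> 0 = id \<and> (\<forall>g h. \<alpha> (g + h) = \<alpha> g \<circ> \<alpha> h) \<and> (\<exists>b. \<forall>g v. \<alpha> g v = \<rho> g v + b g)"

definition continuous_action ::
    "('g::topological_space \<Rightarrow> 'h::real_normed_vector \<Rightarrow> 'h) \<Rightarrow> bool" where
  "continuous_action \<alpha> \<longleftrightarrow> (\<forall>v. continuous_on UNIV (\<lambda>g. \<alpha> g v))"

definition almost_fixes_point ::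
    "('g::topological_space \<Rightarrow> 'h::real_normed_vector \<Rightarrow> 'h) \<Rightarrow> bool" where
  "almost_fixes_point \<alpha> \<longleftrightarrow>
     (\<forall>K \<epsilon>. compact K \<and> \<epsilon> > 0 \<longrightarrow> (\<exists>v. \<forall>g\<in>K. norm (\<alpha> g v - v) < \<epsilon>))"

end

theory Submission
  imports Defs
begin

text \<open>
  Cocycles of degree one are crossed homomorphisms \<open>b\<close>, and the class of \<open>b\<close> vanishes in
  reduced cohomology iff the affine action \<open>\<alpha> g v = \<rho> g v + b g\<close> almost fixes points on compact
  sets. Let \<open>P\<^sub>i\<close> be the projection to the vectors fixed by \<open>G\<^sub>i\<close>. The isomorphism is induced by
  \<open>b \<mapsto> (P\<^sub>2 b|G\<^sub>1, P\<^sub>1 b|G\<^sub>2)\<close>, with right inverse \<open>(b\<^sub>1, b\<^sub>2) \<mapsto> b\<^sub>1 + b\<^sub>2\<close>. For injectivity, the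
  components \<open>P\<^sub>i b\<close> are split off, so that \<open>b\<close> is orthogonal to all vectors fixed by one of the
  factors. The displacement \<open>F g v = \<alpha> g v - v\<close> of \<open>g \<in> G\<^sub>1\<close> satisfies \<open>F g (\<alpha> h v) = \<rho> h (F g v)\<close>
  for \<open>h \<in> G\<^sub>2\<close>. As \<open>0\<close> lies in the closed convex hull of every \<open>\<rho>(G\<^sub>2)\<close>-orbit orthogonal to the
  fixed vectors, the convex hull of the \<open>\<alpha>(G\<^sub>2)\<close>-orbit of \<open>0\<close> contains almost fixed points of
  \<open>G\<^sub>1\<close>.
\<close>

section \<open>Projections in a Hilbert space\<close>

text \<open>The averages over the second factor are plain convex combinations, so each step makes
  one more displacement small and only finitely many can be treated this way. Compact sets are
  reached because every such average \<open>v\<close> satisfies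
  \<open>norm (F g v - F g' v) \<le> norm (F g 0 - F g' 0)\<close>: a finite net for the
  displacements at \<open>0\<close> serves all averages at once.

  A second obstacle is that the almost fixed points found for the two factors are unrelated.
  Nearest-point projections, which exist and are nonexpansive in a Hilbert space, produce one point
  that serves both factors.

  Third, the two fixed spaces overlap in the vectors fixed by the whole group. The part of
  \<open>b\<close> in the overlap has to be removed first: \<open>P\<^sub>1 b\<close> on
  \<open>G\<^sub>1\<close> takes its values there, principal crossed homomorphisms are orthogonal to
  these vectors, and so triviality of the class of \<open>P\<^sub>2 b\<close> on
  \<open>G\<^sub>1\<close> forces \<open>P\<^sub>1 b\<close> to vanish on \<open>G\<^sub>1\<close>.
  Only then does subtracting both projections leave something orthogonal to both fixed
  spaces.\<close>

lemma midpoint_dist_identity: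
  fixes x y p :: "'h::real_inner"
  shows "(dist y p)\<^sup>2 = 2 * (dist x y)\<^sup>2 + 2 * (dist x p)\<^sup>2
           - 4 * (dist x ((1/2) *\<^sub>R y + (1/2) *\<^sub>R p))\<^sup>2"
  by (simp add: dist_norm power2_norm_eq_inner inner_add inner_diff inner_commute algebra_simps)

text \<open>A minimizing sequence is Cauchy: by the parallelogram law, two nearly minimal points
  that are far apart would have a midpoint closer to \<open>x\<close> than the infimum.\<close>

lemma nearest_point_exists:
  fixes C :: "'h::{real_inner,complete_space} set"
  assumes "closed C" "convex C" "C \<noteq> {}"
  shows "\<exists>p\<in>C. \<forall>c\<in>C. dist x p \<le> dist x c"
proof -
  define d where "d = infdist x C"
  have d0: "d \<ge> 0" and dle: "\<And>c. c \<in> C \<Longrightarrow> d \<le> dist x c"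
    by (auto simp: d_def infdist_nonneg infdist_le)
  have "\<exists>c\<in>C. dist x c < d + 1 / Suc n" for n
  proof (rule ccontr)
    assume "\<not> ?thesis"
    then have "\<forall>c\<in>C. d + 1 / Suc n \<le> dist x c" by force
    then have "d + 1 / Suc n \<le> d"
      using \<open>C \<noteq> {}\<close> cINF_greatest[of C "d + 1 / Suc n" "dist x"]
      by (simp add: d_def infdist_def)
    then show False by simp
  qed
  then obtain y where yC: "\<And>n. y n \<in> C" and yd: "\<And>n. dist x (y n) < d + 1 / Suc n"
    by metis
  have lim: "(\<lambda>n. dist x (y n)) \<longlonglongrightarrow> d"
  proof (rule tendsto_sandwich[of "\<lambda>_. d" _ _ "\<lambda>n. d + 1 / Suc n"])
    show "\<forall>\<^sub>F n in sequentially. dist x (y n) \<le> d + 1 / real (Suc n)"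
      using yd by (simp add: less_imp_le)
    show "(\<lambda>n. d + 1 / real (Suc n)) \<longlonglongrightarrow> d"
      using tendsto_add[OF tendsto_const LIMSEQ_inverse_real_of_nat, of d]
      by (simp add: inverse_eq_divide)
  qed (use dle yC in auto)
  have mid: "(1/2) *\<^sub>R y m + (1/2) *\<^sub>R y n \<in> C" for m n
    using \<open>convex C\<close> yC by (auto simp: convex_def)
  have near: "(dist (y m) (y n))\<^sup>2 \<le> 2 * ((dist x (y m))\<^sup>2 - d\<^sup>2) + 2 * ((dist x (y n))\<^sup>2 - d\<^sup>2)"
    for m n
  proof -
    have "d\<^sup>2 \<le> (dist x ((1/2) *\<^sub>R y m + (1/2) *\<^sub>R y n))\<^sup>2"
      using dle[OF mid] d0 by (intro power_mono) auto
    then show ?thesis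
      using midpoint_dist_identity[of "y m" "y n" x] by (simp add: algebra_simps)
  qed
  have "Cauchy y"
  proof (rule metric_CauchyI)
    fix e :: real assume "e > 0"
    have "(\<lambda>n. (dist x (y n))\<^sup>2 - d\<^sup>2) \<longlonglongrightarrow> d\<^sup>2 - d\<^sup>2"
      by (intro tendsto_intros lim)
    then have "\<forall>\<^sub>F n in sequentially. (dist x (y n))\<^sup>2 - d\<^sup>2 < e\<^sup>2 / 4"
      using \<open>e > 0\<close> by (intro order_tendstoD) auto
    then obtain N where N: "\<And>n. n \<ge> N \<Longrightarrow> (dist x (y n))\<^sup>2 - d\<^sup>2 < e\<^sup>2 / 4"
      by (auto simp: eventually_sequentially)
    have "dist (y m) (y n) < e" if "m \<ge> N" "n \<ge> N" for m n
    proof -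
      have "(dist (y m) (y n))\<^sup>2 < e\<^sup>2"
        using near[of m n] N[OF that(1)] N[OF that(2)] by (simp add: field_simps)
      then show ?thesis
        using \<open>e > 0\<close> by (simp add: power_less_imp_less_base)
    qed
    then show "\<exists>M. \<forall>m\<ge>M. \<forall>n\<ge>M. dist (y m) (y n) < e" by blast
  qed
  then obtain p where p: "y \<longlonglongrightarrow> p"
    using Cauchy_convergent_iff convergent_def by blast
  then have "p \<in> C"
    using closed_sequentially \<open>closed C\<close> yC by blast
  moreover have "dist x p = d"
    using LIMSEQ_unique[OF tendsto_dist[OF tendsto_const p] lim] by simp
  ultimately show ?thesis using dle by auto
qed

lemma nearest_point_unique:
  fixes C :: "'h::real_inner set"
  assumes "convex C" "p \<in> C" "q \<in> C"
    and "\<And>c. c \<in> C \<Longrightarrow> dist x p \<le> dist x c" "\<And>c. c \<in> C \<Longrightarrow> dist x q \<le> dist x c"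
  shows "p = q"
proof -
  have "(1/2) *\<^sub>R p + (1/2) *\<^sub>R q \<in> C"
    using assms by (auto simp: convex_def)
  then have "(dist x p)\<^sup>2 \<le> (dist x ((1/2) *\<^sub>R p + (1/2) *\<^sub>R q))\<^sup>2"
    using assms by (intro power_mono) auto
  moreover have "dist x p = dist x q"
    using assms by (intro antisym) auto
  ultimately have "(dist p q)\<^sup>2 \<le> 0"
    using midpoint_dist_identity[of p q x] by simp
  then show ?thesis by simp
qed

text \<open>If the angle at \<open>p\<close> were acute, a short step from \<open>p\<close> towards
  \<open>c\<close> would come closer to \<open>x\<close>.\<close>

lemma nearest_point_variational:
  fixes C :: "'h::real_inner set"
  assumes "convex C" "p \<in> C" "c \<in> C" and near: "\<And>c. c \<in> C \<Longrightarrow> dist x p \<le> dist x c"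
  shows "inner (x - p) (c - p) \<le> 0"
proof (rule ccontr)
  assume "\<not> ?thesis"
  then have pos: "inner (x - p) (c - p) > 0" by simp
  then have n: "(norm (c - p))\<^sup>2 > 0" by auto
  define s where "s = inner (x - p) (c - p)"
  \<comment> \<open>A step of length \<open>t\<close> changes the squared distance by
    \<open>- 2 * t * s + t * (t * (norm (c - p))\<^sup>2)\<close>. The second bound on
    \<open>t\<close> makes this at most \<open>- t * s\<close>, and the bound \<open>1\<close> keeps
    the point on the segment.\<close>
  define t where "t = min 1 (s / (norm (c - p))\<^sup>2)"
  have t: "0 < t" "t \<le> 1" "t * (norm (c - p))\<^sup>2 \<le> s"
    using pos n by (auto simp: t_def s_def min_def field_simps)
  have "p + t *\<^sub>R (c - p) = (1 - t) *\<^sub>R p + t *\<^sub>R c"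
    by (simp add: algebra_simps)
  also have "\<dots> \<in> C"
    using convexD_alt[OF \<open>convex C\<close> \<open>p \<in> C\<close> \<open>c \<in> C\<close>] t by auto
  finally have "(dist x p)\<^sup>2 \<le> (dist x (p + t *\<^sub>R (c - p)))\<^sup>2"
    using near by (intro power_mono) auto
  also have "\<dots> = (dist x p)\<^sup>2 - 2 * t * s + t * (t * (norm (c - p))\<^sup>2)"
    by (simp add: dist_norm power2_norm_eq_inner s_def inner_add inner_diff inner_commute
        algebra_simps)
  also have "\<dots> \<le> (dist x p)\<^sup>2 - 2 * t * s + t * s"
    using t by (intro add_left_mono mult_left_mono) auto
  finally have "t * s \<le> 0" by (simp add: mult.commute)
  then show False using t pos by (simp add: s_def mult_le_0_iff)
qed

text \<open>The sum of the two variational inequalities bounds the square of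
  \<open>norm (p - q)\<close> by \<open>inner (x - y) (p - q)\<close>; Cauchy-Schwarz does the
  rest.\<close>

lemma nearest_point_nonexpansive:
  fixes C :: "'h::real_inner set"
  assumes "convex C" "p \<in> C" "q \<in> C"
    and "\<And>c. c \<in> C \<Longrightarrow> dist x p \<le> dist x c" "\<And>c. c \<in> C \<Longrightarrow> dist y q \<le> dist y c"
  shows "norm (p - q) \<le> norm (x - y)"
proof -
  have "inner (x - p) (q - p) \<le> 0" "inner (y - q) (p - q) \<le> 0"
    using assms by (auto intro!: nearest_point_variational)
  then have "inner (p - q) (p - q) \<le> inner (x - y) (p - q)"
    by (simp add: inner_diff inner_commute algebra_simps)
  also have "\<dots> \<le> norm (x - y) * norm (p - q)" by (rule norm_cauchy_schwarz)
  finally show ?thesis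
    by (cases "p = q") (auto simp: dot_square_norm power2_eq_square)
qed

text \<open>In a subspace the variational inequality holds for \<open>m\<close> and for
  \<open>- m\<close>, so it is an equality.\<close>

lemma orthogonal_projection_exists:
  fixes M :: "'h::{real_inner,complete_space} set"
  assumes "closed M" "subspace M"
  shows "\<exists>p\<in>M. \<forall>m\<in>M. inner (x - p) m = 0"
proof -
  have "M \<noteq> {}" "convex M"
    using assms subspace_0 subspace_imp_convex by auto
  then obtain p where p: "p \<in> M" "\<And>c. c \<in> M \<Longrightarrow> dist x p \<le> dist x c"
    using nearest_point_exists[of M x] assms by blast
  have "inner (x - p) m \<le> 0" if "m \<in> M" for m
    using nearest_point_variational[of M p "p + m" x] p that \<open>convex M\<close> assms
    by (simp add: subspace_add)
  from this this[of "- m" for m] have "inner (x - p) m = 0" if "m \<in> M" for m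
    using that assms subspace_neg by (fastforce intro: antisym)
  with p show ?thesis by blast
qed

lemma isometry_continuous_on:
  fixes f :: "'a::real_normed_vector \<Rightarrow> 'b::real_normed_vector"
  assumes "linear f" "\<And>v. norm (f v) = norm v"
  shows "continuous_on S f"
  using assms by (intro linear_continuous_on linear_conv_bounded_linear[THEN iffD1]
      bounded_linear_intro[where K=1]) (auto simp: linear_add linear_scale)

section \<open>Almost fixed points of commuting affine actions\<close>

text \<open>The point of the closure of \<open>C\<close> nearest to \<open>0\<close> is fixed by uniqueness.\<close>

lemma zero_in_closure_of_invariant_convex:
  fixes C :: "'h::{real_inner,complete_space} set" and L :: "'k \<Rightarrow> 'h \<Rightarrow> 'h"
  assumes "convex C" "C \<noteq> {}"
    and lin: "\<And>k. linear (L k)" and iso: "\<And>k v. norm (L k v) = norm v"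
    and inv: "\<And>k v. v \<in> C \<Longrightarrow> L k v \<in> C"
    and orth: "\<And>v m. v \<in> C \<Longrightarrow> m \<in> fixed_vectors L \<Longrightarrow> inner v m = 0"
  shows "0 \<in> closure C"
proof -
  have cvx: "convex (closure C)" using \<open>convex C\<close> by (rule convex_closure)
  obtain p where p: "p \<in> closure C" "\<And>c. c \<in> closure C \<Longrightarrow> dist 0 p \<le> dist 0 c"
    using nearest_point_exists[of "closure C" 0] cvx \<open>C \<noteq> {}\<close> by auto
  have "L k p = p" for k
  proof -
    have "continuous_on UNIV (L k)"
      using lin iso by (rule isometry_continuous_on)
    then have "L k ` closure C \<subseteq> closure (L k ` C)"
      by (meson continuous_on_subset image_closure_subset closed_closure closure_subset
          subset_UNIV)
    also have "\<dots> \<subseteq> closure C" using inv by (intro closure_mono) auto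
    finally have "L k p \<in> closure C" using p by auto
    \<comment> \<open>As \<open>L k\<close> preserves norms, \<open>L k p\<close> is as close to
      \<open>0\<close> as \<open>p\<close> is.\<close>
    then show ?thesis
      using p iso cvx by (intro nearest_point_unique[of "closure C" _ _ 0]) auto
  qed
  then have fixed: "p \<in> fixed_vectors L" by (simp add: fixed_vectors_def)
  \<comment> \<open>Orthogonality to the fixed vector \<open>p\<close> passes from \<open>C\<close>
    to its closure, which contains \<open>p\<close> itself.\<close>
  have "closure C \<subseteq> {v. inner v p = 0}"
    using orth fixed by (intro closure_minimal closed_Collect_eq continuous_intros) auto
  then have "p = 0" using p by auto
  then show ?thesis using p by simp
qed

text \<open>For a single \<open>g\<close>, the values of \<open>F g\<close> on an
  \<open>A\<close>-invariant convex set form an \<open>L\<close>-invariant convex set, so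
  orthogonality to the fixed vectors puts \<open>0\<close> in its closure. The points where finitely
  many displacements are already small form such an \<open>A\<close>-invariant convex set again, so
  elements \<open>g\<close> can be added one by one.\<close>

lemma almost_common_zero:
  fixes L A :: "'k \<Rightarrow> 'h \<Rightarrow> 'h::{real_inner,complete_space}" and F :: "'g \<Rightarrow> 'h \<Rightarrow> 'h"
  assumes lin: "\<And>k. linear (L k)" and iso: "\<And>k v. norm (L k v) = norm v"
    and A: "\<And>k u w x y. u + w = 1 \<Longrightarrow> A k (u *\<^sub>R x + w *\<^sub>R y) = u *\<^sub>R A k x + w *\<^sub>R A k y"
    and F: "\<And>g u w x y. u + w = 1 \<Longrightarrow> F g (u *\<^sub>R x + w *\<^sub>R y) = u *\<^sub>R F g x + w *\<^sub>R F g y"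
    and equiv: "\<And>g k v. F g (A k v) = L k (F g v)"
    and orth: "\<And>g m. m \<in> fixed_vectors L \<Longrightarrow> inner (F g 0) m = 0"
    and K: "compact ((\<lambda>g. F g 0) ` K)" and e: "e > 0"
  shows "\<exists>v. \<forall>g\<in>K. norm (F g v) < e"
proof -
  \<comment> \<open>This set contains the convex hull of the \<open>A\<close>-orbit of
    \<open>0\<close>: both conditions hold at \<open>0\<close>, survive convex combinations and are
    preserved by \<open>A k\<close>, which acts on the values of \<open>F\<close> as the isometry
    \<open>L k\<close>. The second condition carries estimates from a finite net over to all of
    \<open>K\<close>.\<close>
  define good where "good = {v. (\<forall>g. \<forall>m\<in>fixed_vectors L. inner (F g v) m = 0) \<and>
      (\<forall>g g'. norm (F g v - F g' v) \<le> norm (F g 0 - F g' 0))}"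
  have isoinner: "inner (L k x) (L k y) = inner x y" for k x y
    using iso[of k "x + y"] iso[of k x] iso[of k y] lin
    by (simp add: linear_add dot_norm)
  have good0: "0 \<in> good" using orth by (simp add: good_def)
  have goodA: "A k v \<in> good" if v: "v \<in> good" for k v
  proof -
    have "inner (L k (F g v)) m = 0" if "m \<in> fixed_vectors L" for g m
    proof -
      have "inner (L k (F g v)) m = inner (L k (F g v)) (L k m)"
        using that by (simp add: fixed_vectors_def)
      then show ?thesis using v that by (simp add: isoinner good_def)
    qed
    moreover have "norm (L k (F g v) - L k (F g' v)) = norm (F g v - F g' v)" for g g'
      using iso lin by (metis linear_diff)
    ultimately show ?thesis using v by (simp add: good_def equiv)
  qed
  have goodC: "convex good"
  proof (rule convexI)
    fix x y and u w :: real
    assume xy: "x \<in> good" "y \<in> good" and uw: "0 \<le> u" "0 \<le> w" "u + w = 1"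
    have "norm (F g (u *\<^sub>R x + w *\<^sub>R y) - F g' (u *\<^sub>R x + w *\<^sub>R y)) \<le> norm (F g 0 - F g' 0)"
      for g g'
    proof -
      have "F g (u *\<^sub>R x + w *\<^sub>R y) - F g' (u *\<^sub>R x + w *\<^sub>R y)
        = u *\<^sub>R (F g x - F g' x) + w *\<^sub>R (F g y - F g' y)"
        using uw by (simp add: F algebra_simps)
      also have "norm \<dots> \<le> u * norm (F g x - F g' x) + w * norm (F g y - F g' y)"
        using uw by (intro norm_triangle_le) simp
      also have "\<dots> \<le> u * norm (F g 0 - F g' 0) + w * norm (F g 0 - F g' 0)"
        using uw xy by (intro add_mono mult_left_mono) (auto simp: good_def)
      also have "\<dots> = norm (F g 0 - F g' 0)"
        using uw by (metis distrib_right mult_1)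
      finally show ?thesis .
    qed
    then show "u *\<^sub>R x + w *\<^sub>R y \<in> good"
      using xy uw by (auto simp: good_def F inner_add_left)
  qed
  have fin: "\<exists>v\<in>good. \<forall>g\<in>T. norm (F g v) < e / 2" if "finite T" for T
  proof -
    \<comment> \<open>The bound \<open>e / 2\<close> leaves the other half for passing from the net
      \<open>T\<close> to \<open>K\<close>. The set is invariant because \<open>F g (A k v)\<close>
      and \<open>F g v\<close> have equal norm.\<close>
    define near where "near S = {v \<in> good. \<forall>g\<in>S. norm (F g v) < e / 2}" for S
    have nearA: "A k v \<in> near S" if "v \<in> near S" for k v S
      using that goodA by (auto simp: near_def equiv iso)
    have nearC: "convex (near S)" for S
    proof (rule convexI)
      fix x y and u w :: real
      assume xy: "x \<in> near S" "y \<in> near S" and uw: "0 \<le> u" "0 \<le> w" "u + w = 1"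
      have "norm (F g (u *\<^sub>R x + w *\<^sub>R y)) < e / 2" if "g \<in> S" for g
        using convexD[OF convex_ball[of 0 "e/2"], of "F g x" "F g y" u w] xy uw that
        by (auto simp: near_def F)
      then show "u *\<^sub>R x + w *\<^sub>R y \<in> near S"
        using xy uw convexD[OF goodC] by (auto simp: near_def)
    qed
    from that have "near T \<noteq> {}"
    proof (induction T)
      case empty
      then show ?case using good0 by (auto simp: near_def)
    next
      case (insert g T)
      have "0 \<in> closure (F g ` near T)"
      proof (rule zero_in_closure_of_invariant_convex[OF _ _ lin iso])
        show "convex (F g ` near T)"
        proof (rule convexI)
          fix x y and u w :: real
          assume "x \<in> F g ` near T" "y \<in> F g ` near T" and uw: "0 \<le> u" "0 \<le> w" "u + w = 1"
          then obtain x' y' where "x' \<in> near T" "y' \<in> near T" "x = F g x'" "y = F g y'"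
            by blast
          then show "u *\<^sub>R x + w *\<^sub>R y \<in> F g ` near T"
            using uw convexD[OF nearC, of x' T y' u w]
            by (intro image_eqI[of _ _ "u *\<^sub>R x' + w *\<^sub>R y'"]) (auto simp: F)
        qed
        show "L k v \<in> F g ` near T" if v: "v \<in> F g ` near T" for k v
        proof -
          obtain v' where "v' \<in> near T" "v = F g v'" using v by blast
          then show ?thesis using nearA[of v' T k] equiv[of g k v'] by (metis imageI)
        qed
        show "inner v m = 0" if "v \<in> F g ` near T" "m \<in> fixed_vectors L" for v m
          using that by (auto simp: near_def good_def)
      qed (use insert in auto)
      then obtain v where "v \<in> near T" "dist (F g v) 0 < e / 2"
        using e by (metis closure_approachable half_gt_zero imageE)
      then have "v \<in> near (insert g T)" by (auto simp: near_def)
      then show ?case by blast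
    qed
    then show ?thesis by (auto simp: near_def)
  qed
  obtain T where T: "finite T" "T \<subseteq> K" "(\<lambda>g. F g 0) ` K \<subseteq> (\<Union>g\<in>T. ball (F g 0) (e / 2))"
    using compactE_image[OF K, of K "\<lambda>g. ball (F g 0) (e / 2)"] e
    by (smt (verit, best) UN_I centre_in_ball image_subset_iff half_gt_zero open_ball)
  obtain v where v: "v \<in> good" "\<And>g. g \<in> T \<Longrightarrow> norm (F g v) < e / 2"
    using fin[OF T(1)] by blast
  have "norm (F g v) < e" if g: "g \<in> K" for g
  proof -
    obtain t where "t \<in> T" "dist (F t 0) (F g 0) < e / 2" using T g by fastforce
    moreover have "norm (F g v - F t v) \<le> norm (F g 0 - F t 0)"
      using v by (simp add: good_def)
    ultimately show ?thesis
      using v(2)[of t] norm_triangle_sub[of "F g v" "F t v"]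
      by (simp add: dist_norm norm_minus_commute)
  qed
  then show ?thesis by blast
qed

section \<open>Unitary representations and crossed homomorphisms\<close>

lemma cinner_scaleC_right: "cinner x (a *\<^sub>C y) = a * cinner x (y :: 'h::complex_hilbert_space)"
  using cinner_commute[of x "a *\<^sub>C y"] cinner_commute[of x y] by (simp add: cinner_scaleC_left)

lemma inner_scaleC_left: "inner (a *\<^sub>C x) y = inner x (cnj a *\<^sub>C (y :: 'h::complex_hilbert_space))"
  by (simp add: Re_cinner[symmetric] cinner_scaleC_left cinner_scaleC_right)

lemma unitary_linear: "unitary U \<Longrightarrow> linear U"
  unfolding unitary_def by (intro linearI) (auto simp: scaleC_complex_of_real[symmetric])

lemma unitary_inner: "unitary U \<Longrightarrow> inner (U x) (U y) = inner x y"
  by (simp add: unitary_def Re_cinner[symmetric])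

lemma unitary_norm: "unitary U \<Longrightarrow> norm (U x) = norm x"
  by (simp add: norm_eq_sqrt_inner unitary_inner)

locale unitary_rep =
  fixes \<rho> :: "'g::topological_group_add \<Rightarrow> 'h::complex_hilbert_space \<Rightarrow> 'h"
  assumes rep: "continuous_unitary_rep \<rho>"
begin

lemma unitary: "unitary (\<rho> g)"
  using rep by (simp add: continuous_unitary_rep_def)

lemma linear: "linear (\<rho> g)"
  by (rule unitary_linear[OF unitary])

lemmas add = linear_add[OF linear] and diff = linear_diff[OF linear]
  and scale = linear_scale[OF linear] and neg = linear_neg[OF linear]
  and zero_right [simp] = linear_0[OF linear]
  and norm [simp] = unitary_norm[OF unitary]
  and inner [simp] = unitary_inner[OF unitary]

lemma scaleC: "\<rho> g (a *\<^sub>C x) = a *\<^sub>C \<rho> g x"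
  using unitary by (simp add: unitary_def)

lemma plus: "\<rho> (g + h) v = \<rho> g (\<rho> h v)"
  using rep by (simp add: continuous_unitary_rep_def)

text \<open>Multiplicativity makes \<open>\<rho> 0\<close> idempotent, and an idempotent isometry is
  the identity because it is injective.\<close>

lemma zero [simp]: "\<rho> 0 v = v"
proof -
  have "\<rho> 0 (\<rho> 0 v - v) = 0" using plus[of 0 0 v] by (simp add: diff)
  then show ?thesis using norm[of 0 "\<rho> 0 v - v"] by simp
qed

lemma inverse_right [simp]: "\<rho> g (\<rho> (- g) v) = v"
  using plus[of g "- g" v] by simp

lemma continuous_orbit: "continuous_on S (\<lambda>g. \<rho> g v)"
  using rep continuous_on_subset unfolding continuous_unitary_rep_def by blast

lemma continuous_on_rep: "continuous_on S f \<Longrightarrow> continuous_on S (\<lambda>x. \<rho> g (f x))"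
  using isometry_continuous_on[OF linear norm] continuous_on_compose2 by blast

end

lemma unitary_rep_product_factors:
  fixes \<rho> :: "'a::topological_group_add \<times> 'b::topological_group_add \<Rightarrow>
                'h::complex_hilbert_space \<Rightarrow> 'h"
  assumes "unitary_rep \<rho>"
  shows "unitary_rep (\<lambda>g. \<rho> (g, 0))" and "unitary_rep (\<lambda>g. \<rho> (0, g))"
proof -
  interpret unitary_rep \<rho> by fact
  have *: "(g + h, 0::'b) = (g, 0) + (h, 0)" "(0::'a, k + l) = (0, k) + (0, l)"
    for g h :: 'a and k l :: 'b
    by simp_all
  show "unitary_rep (\<lambda>g. \<rho> (g, 0))" "unitary_rep (\<lambda>g. \<rho> (0, g))"
    unfolding unitary_rep_def continuous_unitary_rep_def *
    by (auto simp: unitary plus fun_eq_iff simp del: add_Pair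
        intro!: continuous_on_compose2[OF continuous_orbit[of UNIV]] continuous_intros)
qed

definition crossed_homs ::
    "('g::topological_group_add \<Rightarrow> 'v::complex_normed_vector \<Rightarrow> 'v) \<Rightarrow> 'v set \<Rightarrow> ('g \<Rightarrow> 'v) set"
  where
  "crossed_homs \<rho> V = {b. continuous_on UNIV b \<and> range b \<subseteq> V \<and>
     (\<forall>g h. b (g + h) = b g + \<rho> g (b h))}"

text \<open>This is the closure of the principal crossed homomorphisms \<open>\<rho> g v - v\<close>
  under uniform convergence on compact sets. The norm is the displacement of the point
  \<open>- v\<close> under the affine map \<open>\<rho> g v + b g\<close>.\<close>

definition approx_principal ::
    "('g::topological_group_add \<Rightarrow> 'v::complex_normed_vector \<Rightarrow> 'v) \<Rightarrow> 'v set \<Rightarrow> ('g \<Rightarrow> 'v) \<Rightarrow> bool"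
  where
  "approx_principal \<rho> V b \<longleftrightarrow> (\<forall>K e. compact K \<and> e > 0 \<longrightarrow>
     (\<exists>v\<in>V. \<forall>g\<in>K. norm (b g - (\<rho> g v - v)) < e))"

lemma crossed_homD:
  assumes "b \<in> crossed_homs \<rho> V"
  shows "continuous_on S b" "b g \<in> V" "b (g + h) = b g + \<rho> g (b h)"
  using assms continuous_on_subset by (auto simp: crossed_homs_def image_subset_iff)

section \<open>Almost fixed points for a product\<close>

text \<open>The assumptions \<open>commute\<close> say that the affine maps
  \<open>T g v + b g\<close> and \<open>L k v + c k\<close> commute. The displacement of the first
  map at \<open>L k v + c k\<close> is then \<open>L k\<close> of its displacement at
  \<open>v\<close>, since the translation parts cancel; this is the equivariance that the averaging
  needs.\<close>

lemma almost_fixed_by_one_factor: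
  fixes L :: "'k \<Rightarrow> 'h \<Rightarrow> 'h::{real_inner,complete_space}" and T :: "'g \<Rightarrow> 'h \<Rightarrow> 'h"
  assumes lin: "\<And>k. linear (L k)" "\<And>g. linear (T g)" and iso: "\<And>k v. norm (L k v) = norm v"
    and commute: "\<And>g k v. T g (L k v) = L k (T g v)"
      "\<And>g k. b g + T g (c k) = c k + L k (b g)"
    and orth: "\<And>g m. m \<in> fixed_vectors L \<Longrightarrow> inner (b g) m = 0"
    and K: "compact (b ` K)" and e: "e > 0"
  shows "\<exists>v. \<forall>g\<in>K. norm (T g v + b g - v) < e"
proof (rule almost_common_zero[where L = L and A = "\<lambda>k v. L k v + c k"
      and F = "\<lambda>g v. T g v + b g - v", OF lin(1) iso _ _ _ _ _ e])
  \<comment> \<open>Translation parts are distributed over a convex combination with the same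
    weights; this is where \<open>u + w = 1\<close> enters.\<close>
  have split: "z = u *\<^sub>R z + w *\<^sub>R z" if "u + w = 1" for u w and z :: 'h
    using that by (metis scaleR_add_left scaleR_one)
  show "L k (u *\<^sub>R x + w *\<^sub>R y) + c k = u *\<^sub>R (L k x + c k) + w *\<^sub>R (L k y + c k)"
    if "u + w = 1" for k u w x y
    using split[OF that, of "c k"]
    by (simp add: linear_add[OF lin(1)] linear_scale[OF lin(1)] algebra_simps)
  show "T g (u *\<^sub>R x + w *\<^sub>R y) + b g - (u *\<^sub>R x + w *\<^sub>R y)
      = u *\<^sub>R (T g x + b g - x) + w *\<^sub>R (T g y + b g - y)"
    if "u + w = 1" for g u w x y
    using split[OF that, of "b g"]
    by (simp add: linear_add[OF lin(2)] linear_scale[OF lin(2)] algebra_simps)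
  show "T g (L k v + c k) + b g - (L k v + c k) = L k (T g v + b g - v)" for g k v
    using commute(2)[of g k]
    by (simp add: linear_add[OF lin(1)] linear_diff[OF lin(1)] linear_add[OF lin(2)]
        commute(1) algebra_simps)
qed (use K orth lin in \<open>simp_all add: linear_0\<close>)

text \<open>
  An almost fixed point of the second factor is projected to the closed convex set of almost
  fixed points of the first factor. This set is invariant under the second factor, so the
  projection commutes with the second factor and does not increase displacements.
\<close>

lemma product_approx_principal_if_orthogonal:
  fixes \<rho> :: "'g1::topological_group_add \<times> 'g2::topological_group_add \<Rightarrow>
                'h::complex_hilbert_space \<Rightarrow> 'h"
  assumes "unitary_rep \<rho>" and b: "b \<in> crossed_homs \<rho> UNIV"
    and orth1: "\<And>g m. m \<in> fixed_vectors (\<lambda>g. \<rho> (g, 0)) \<Longrightarrow> inner (b g) m = 0"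
    and orth2: "\<And>g m. m \<in> fixed_vectors (\<lambda>g. \<rho> (0, g)) \<Longrightarrow> inner (b g) m = 0"
  shows "approx_principal \<rho> UNIV b"
  unfolding approx_principal_def
proof (intro allI impI)
  fix K :: "('g1 \<times> 'g2) set" and e :: real
  assume "compact K \<and> 0 < e"
  then have K: "compact K" and e: "e / 2 > 0" by auto
  interpret unitary_rep \<rho> by fact
  note b_add = crossed_homD(3)[OF b]
  have swap: "\<rho> (g, 0) (\<rho> (0, k) v) = \<rho> (0, k) (\<rho> (g, 0) v)" for g k v
    by (simp flip: plus)
  have swapb: "b (g, 0) + \<rho> (g, 0) (b (0, k)) = b (0, k) + \<rho> (0, k) (b (g, 0))" for g k
    by (simp flip: b_add)
  have compact1: "compact ((\<lambda>g. b (g, 0)) ` fst ` K)" and compact2: "compact ((\<lambda>k. b (0, k)) ` snd ` K)"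
    by (intro compact_continuous_image continuous_intros K
        continuous_on_compose2[OF crossed_homD(1)[OF b, of UNIV]]; simp)+
  have "\<exists>v. \<forall>g\<in>fst ` K. norm (\<rho> (g, 0) v + b (g, 0) - v) < e / 2"
    by (rule almost_fixed_by_one_factor[where L = "\<lambda>k. \<rho> (0, k)" and c = "\<lambda>k. b (0, k)"])
       (auto simp: linear swap swapb orth2 \<open>compact K \<and> 0 < e\<close> intro: compact1)
  then obtain y1 where y1: "\<And>g. g \<in> fst ` K \<Longrightarrow> norm (\<rho> (g, 0) y1 + b (g, 0) - y1) < e / 2"
    by blast
  have "\<exists>v. \<forall>k\<in>snd ` K. norm (\<rho> (0, k) v + b (0, k) - v) < e / 2"
    by (rule almost_fixed_by_one_factor[where L = "\<lambda>g. \<rho> (g, 0)" and c = "\<lambda>g. b (g, 0)"])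
       (auto simp: linear swap swapb[symmetric] orth1 \<open>compact K \<and> 0 < e\<close> intro: compact2)
  then obtain y2 where y2: "\<And>k. k \<in> snd ` K \<Longrightarrow> norm (\<rho> (0, k) y2 + b (0, k) - y2) < e / 2"
    by blast
  \<comment> \<open>The non-strict inequality makes \<open>D\<close> closed. The strict bound for
    the second factor will turn the sum of the two halves into a strict bound by
    \<open>e\<close>.\<close>
  define D where "D = {v. \<forall>g\<in>fst ` K. norm (\<rho> (g, 0) v + b (g, 0) - v) \<le> e / 2}"
  define \<alpha> where "\<alpha> k v = \<rho> (0, k) v + b (0, k)" for k v
  have "y1 \<in> D" using y1 by (auto simp: D_def intro: less_imp_le)
  have "closed D"
    unfolding D_def Collect_ball_eq
    by (intro closed_INT ballI closed_Collect_le continuous_intros continuous_on_rep)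
  have "convex D"
  proof (rule convexI)
    fix x y and u w :: real
    assume xy: "x \<in> D" "y \<in> D" and uw: "0 \<le> u" "0 \<le> w" "u + w = 1"
    have "norm (\<rho> (g, 0) (u *\<^sub>R x + w *\<^sub>R y) + b (g, 0) - (u *\<^sub>R x + w *\<^sub>R y)) \<le> e / 2"
      if "g \<in> fst ` K" for g
    proof -
      have "b (g, 0) = u *\<^sub>R b (g, 0) + w *\<^sub>R b (g, 0)"
        using uw by (metis scaleR_add_left scaleR_one)
      then have eq: "\<rho> (g, 0) (u *\<^sub>R x + w *\<^sub>R y) + b (g, 0) - (u *\<^sub>R x + w *\<^sub>R y)
        = u *\<^sub>R (\<rho> (g, 0) x + b (g, 0) - x) + w *\<^sub>R (\<rho> (g, 0) y + b (g, 0) - y)"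
        by (simp add: add scale algebra_simps)
      show ?thesis
        unfolding eq
        using convexD[OF convex_cball[of 0 "e/2"], of "\<rho> (g, 0) x + b (g, 0) - x"
            "\<rho> (g, 0) y + b (g, 0) - y" u w] xy uw that
        by (auto simp: D_def)
    qed
    then show "u *\<^sub>R x + w *\<^sub>R y \<in> D" by (simp add: D_def)
  qed
  have \<alpha>D: "\<alpha> k v \<in> D" if "v \<in> D" for k v
  proof -
    have "\<rho> (g, 0) (\<alpha> k v) + b (g, 0) - \<alpha> k v = \<rho> (0, k) (\<rho> (g, 0) v + b (g, 0) - v)" for g
      using swapb[of g k] by (simp add: \<alpha>_def add diff swap algebra_simps)
    then show ?thesis using that by (simp add: D_def)
  qed
  have \<alpha>_dist: "dist (\<alpha> k v) (\<alpha> k w) = dist v w" for k v w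
    by (simp add: \<alpha>_def dist_norm flip: diff)
  have \<alpha>_inverse: "\<alpha> k (\<alpha> (- k) v) = v" for k v
  proof -
    have "b 0 = 0" using b_add[of 0 0] by simp
    then have "\<rho> (0, k) (b (0, - k)) + b (0, k) = 0"
      using b_add[of "(0, k)" "(0, - k)"] by (simp add: zero_prod_def add.commute)
    moreover have "\<rho> (0, k) (\<rho> (0, - k) v) = v"
      using inverse_right[of "(0, k)" v] by simp
    ultimately show ?thesis by (simp add: \<alpha>_def add algebra_simps)
  qed
  obtain p where p: "p \<in> D" "\<And>c. c \<in> D \<Longrightarrow> dist y2 p \<le> dist y2 c"
    using nearest_point_exists[OF \<open>closed D\<close> \<open>convex D\<close>] \<open>y1 \<in> D\<close> by blast
  have moved: "norm (\<alpha> k p - p) < e / 2" if k: "k \<in> snd ` K" for k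
  proof -
    \<comment> \<open>A competitor \<open>c\<close> for the point nearest to
      \<open>\<alpha> k y2\<close> is pulled back by \<open>\<alpha> (- k)\<close>, which also
      preserves \<open>D\<close>, to a competitor for \<open>p\<close>.\<close>
    have "dist (\<alpha> k y2) (\<alpha> k p) \<le> dist (\<alpha> k y2) c" if "c \<in> D" for c
      using p(2)[OF \<alpha>D[OF that, of "- k"]] \<alpha>_dist[of k y2 "\<alpha> (- k) c"]
      by (simp add: \<alpha>_dist \<alpha>_inverse)
    then have "norm (\<alpha> k p - p) \<le> norm (\<alpha> k y2 - y2)"
      using p \<alpha>D \<open>convex D\<close> by (intro nearest_point_nonexpansive[of D]) auto
    then show ?thesis using y2[OF k] by (simp add: \<alpha>_def)
  qed
  \<comment> \<open>An almost fixed point \<open>p\<close> gives the approximating vector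
    \<open>- p\<close>. The displacement of \<open>p\<close> under \<open>(g, 0) + (0, k)\<close> is
    that of \<open>(g, 0)\<close> plus that of \<open>(0, k)\<close> transported by the isometry
    \<open>\<rho> (g, 0)\<close>.\<close>
  have "norm (b x - (\<rho> x (- p) - (- p))) < e" if "x \<in> K" for x
  proof (cases x)
    case (Pair g k)
    have gk: "x = (g, 0) + (0, k)" using Pair by simp
    have g: "g \<in> fst ` K" and k: "k \<in> snd ` K" using that Pair by force+
    have "b x - (\<rho> x (- p) - (- p))
        = \<rho> (g, 0) (\<alpha> k p - p) + (\<rho> (g, 0) p + b (g, 0) - p)"
      unfolding gk b_add plus by (simp add: \<alpha>_def add diff neg algebra_simps)
    also have "norm \<dots> < e"
      using moved[OF k] p(1) g norm_triangle_ineq[of "\<rho> (g, 0) (\<alpha> k p - p)" "\<rho> (g, 0) p + b (g, 0) - p"]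
      by (fastforce simp: D_def)
    finally show ?thesis .
  qed
  then show "\<exists>v\<in>UNIV. \<forall>g\<in>K. norm (b g - (\<rho> g v - v)) < e" by blast
qed

section \<open>Invariant subspaces\<close>

locale invariant_subspace = unitary_rep \<rho>
  for \<rho> :: "'g::topological_group_add \<Rightarrow> 'h::complex_hilbert_space \<Rightarrow> 'h" +
  fixes M :: "'h set"
  assumes M_closed: "closed M" and M_zero: "0 \<in> M"
    and M_add: "\<And>x y. x \<in> M \<Longrightarrow> y \<in> M \<Longrightarrow> x + y \<in> M"
    and M_scaleC: "\<And>a x. x \<in> M \<Longrightarrow> a *\<^sub>C x \<in> M"
    and M_invariant: "\<And>g x. x \<in> M \<Longrightarrow> \<rho> g x \<in> M"
begin

lemma M_subspace: "subspace M"
  using M_zero M_add M_scaleC[of _ "complex_of_real r" for r]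
  by (auto simp: subspace_def scaleC_complex_of_real)

lemma M_diff: "x \<in> M \<Longrightarrow> y \<in> M \<Longrightarrow> x - y \<in> M"
  by (rule subspace_diff[OF M_subspace])

text \<open>Real orthogonality already determines the point. As \<open>M\<close> is a complex
  subspace, it amounts to complex orthogonality, which makes \<open>proj\<close> complex
  linear.\<close>

definition proj :: "'h \<Rightarrow> 'h"
  where "proj x = (SOME p. p \<in> M \<and> (\<forall>m\<in>M. inner (x - p) m = 0))"

lemma proj_mem: "proj x \<in> M" and proj_orth: "m \<in> M \<Longrightarrow> inner (x - proj x) m = 0"
proof -
  have "proj x \<in> M \<and> (\<forall>m\<in>M. inner (x - proj x) m = 0)"
    unfolding proj_def
    using orthogonal_projection_exists[OF M_closed M_subspace, of x]
    by (intro someI_ex[of "\<lambda>p. p \<in> M \<and> (\<forall>m\<in>M. inner (x - p) m = 0)"]) blast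
  then show "proj x \<in> M" "m \<in> M \<Longrightarrow> inner (x - proj x) m = 0" by auto
qed

lemma proj_eqI:
  assumes "p \<in> M" "\<And>m. m \<in> M \<Longrightarrow> inner (x - p) m = 0"
  shows "proj x = p"
proof -
  have "inner (p - proj x) (p - proj x) = inner (x - proj x) (p - proj x) - inner (x - p) (p - proj x)"
    by (simp add: inner_diff_left)
  also have "\<dots> = 0"
    using assms proj_mem proj_orth M_diff by simp
  finally show ?thesis by simp
qed

lemma proj_fix: "x \<in> M \<Longrightarrow> proj x = x"
  by (rule proj_eqI) auto

lemma proj_add: "proj (x + y) = proj x + proj y"
proof (rule proj_eqI)
  show "inner (x + y - (proj x + proj y)) m = 0" if "m \<in> M" for m
    using proj_orth[OF that, of x] proj_orth[OF that, of y]
    by (simp add: inner_diff_left inner_add_left)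
qed (simp add: M_add proj_mem)

lemma proj_scaleC: "proj (a *\<^sub>C x) = a *\<^sub>C proj x"
proof (rule proj_eqI)
  have "a *\<^sub>C x = a *\<^sub>C (x - proj x) + a *\<^sub>C proj x"
    by (metis diff_add_cancel scaleC_add_right)
  then have eq: "a *\<^sub>C x - a *\<^sub>C proj x = a *\<^sub>C (x - proj x)" by simp
  show "inner (a *\<^sub>C x - a *\<^sub>C proj x) m = 0" if "m \<in> M" for m
    unfolding eq inner_scaleC_left using that by (intro proj_orth M_scaleC)
qed (simp add: M_scaleC proj_mem)

lemma proj_linear: "linear proj"
  by (rule linearI) (simp_all add: proj_add proj_scaleC flip: scaleC_complex_of_real)

lemmas proj_diff = linear_diff[OF proj_linear]

lemma proj_norm_le: "norm (proj x) \<le> norm x"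
proof -
  have "inner (proj x) (proj x) = inner x (proj x)"
    using proj_orth[OF proj_mem, of x x] by (simp add: inner_diff_left)
  also have "\<dots> \<le> norm x * norm (proj x)" by (rule norm_cauchy_schwarz)
  finally show ?thesis
    by (cases "proj x = 0") (auto simp: dot_square_norm power2_eq_square)
qed

lemma proj_continuous_on: "continuous_on S f \<Longrightarrow> continuous_on S (\<lambda>x. proj (f x))"
proof -
  have "bounded_linear proj"
    using proj_norm_le by (intro bounded_linear_intro[where K=1])
      (auto simp: linear_add[OF proj_linear] linear_scale[OF proj_linear])
  then show "continuous_on S f \<Longrightarrow> continuous_on S (\<lambda>x. proj (f x))"
    by (rule bounded_linear.continuous_on)
qed

text \<open>Since \<open>\<rho> (- g)\<close> preserves \<open>M\<close>, the isometry
  \<open>\<rho> g\<close> preserves the orthogonal complement as well.\<close>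

lemma proj_rep: "proj (\<rho> g x) = \<rho> g (proj x)"
proof (rule proj_eqI)
  show "inner (\<rho> g x - \<rho> g (proj x)) m = 0" if "m \<in> M" for m
  proof -
    have "inner (\<rho> g x - \<rho> g (proj x)) m = inner (\<rho> g (x - proj x)) (\<rho> g (\<rho> (- g) m))"
      by (simp add: diff)
    also have "\<dots> = 0"
      unfolding inner using that by (intro proj_orth M_invariant)
    finally show ?thesis .
  qed
qed (simp add: M_invariant proj_mem)

end

section \<open>Vectors fixed by a normal subgroup\<close>

lemma (in unitary_rep) invariant_subspace_fixed_vectors:
  assumes normal: "\<And>k g. \<exists>k'. j k + g = g + j k'"
  shows "invariant_subspace \<rho> (fixed_vectors (\<lambda>k. \<rho> (j k)))"
proof unfold_locales
  have "fixed_vectors (\<lambda>k. \<rho> (j k)) = (\<Inter>k. {v. \<rho> (j k) v = v})"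
    by (auto simp: fixed_vectors_def)
  then show "closed (fixed_vectors (\<lambda>k. \<rho> (j k)))"
    by (simp add: closed_INT closed_Collect_eq continuous_on_rep)
  show "\<rho> g x \<in> fixed_vectors (\<lambda>k. \<rho> (j k))" if "x \<in> fixed_vectors (\<lambda>k. \<rho> (j k))" for g x
  proof -
    have "\<rho> (j k) (\<rho> g x) = \<rho> g x" for k
    proof -
      obtain k' where "j k + g = g + j k'" using normal[of k g] ..
      moreover have "\<rho> (j k') x = x" using that by (simp add: fixed_vectors_def)
      ultimately show ?thesis using plus[of "j k" g x] plus[of g "j k'" x] by simp
    qed
    then show ?thesis by (simp add: fixed_vectors_def)
  qed
qed (auto simp: fixed_vectors_def add scaleC)

text \<open>Both factors are normal in the product. Hence each fixed space is a module for the whole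
  product, and both projections commute with all of \<open>\<rho>\<close>. The witnesses are
  conjugates of \<open>k\<close>.\<close>

lemma invariant_subspace_fixed_vectors_factors:
  fixes \<rho> :: "'g1::topological_group_add \<times> 'g2::topological_group_add \<Rightarrow>
                'h::complex_hilbert_space \<Rightarrow> 'h"
  assumes "unitary_rep \<rho>"
  shows "invariant_subspace \<rho> (fixed_vectors (\<lambda>g. \<rho> (g, 0)))"
    and "invariant_subspace \<rho> (fixed_vectors (\<lambda>g. \<rho> (0, g)))"
proof -
  have "\<exists>k'. (k, 0) + g = g + (k', 0)" for k :: 'g1 and g :: "'g1 \<times> 'g2"
    by (intro exI[of _ "- fst g + k + fst g"]) (simp add: prod_eq_iff add.assoc)
  then show "invariant_subspace \<rho> (fixed_vectors (\<lambda>g. \<rho> (g, 0)))"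
    by (rule unitary_rep.invariant_subspace_fixed_vectors[OF assms])
  have "\<exists>k'. (0, k) + g = g + (0, k')" for k :: 'g2 and g :: "'g1 \<times> 'g2"
    by (intro exI[of _ "- snd g + k + snd g"]) (simp add: prod_eq_iff add.assoc)
  then show "invariant_subspace \<rho> (fixed_vectors (\<lambda>g. \<rho> (0, g)))"
    by (rule unitary_rep.invariant_subspace_fixed_vectors[OF assms])
qed

lemma (in invariant_subspace) proj_crossed_hom:
  assumes "b \<in> crossed_homs \<rho> V"
  shows "(\<lambda>g. proj (b g)) \<in> crossed_homs \<rho> M"
  using crossed_homD[OF assms]
  by (auto simp: crossed_homs_def proj_mem proj_add proj_rep intro: proj_continuous_on)

lemma (in invariant_subspace) proj_approx_principal:
  assumes "approx_principal \<rho> V b"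
  shows "approx_principal \<rho> M (\<lambda>g. proj (b g))"
  unfolding approx_principal_def
proof (intro allI impI)
  fix K :: "'g set" and e :: real
  assume "compact K \<and> 0 < e"
  then obtain v where v: "\<And>g. g \<in> K \<Longrightarrow> norm (b g - (\<rho> g v - v)) < e"
    using assms unfolding approx_principal_def by meson
  have "norm (proj (b g) - (\<rho> g (proj v) - proj v)) < e" if "g \<in> K" for g
    using v[OF that] proj_norm_le[of "b g - (\<rho> g v - v)"]
    by (simp add: proj_diff proj_rep)
  then show "\<exists>v\<in>M. \<forall>g\<in>K. norm (proj (b g) - (\<rho> g v - v)) < e"
    using proj_mem by blast
qed

lemma crossed_hom_compose:
  assumes "b \<in> crossed_homs \<rho> V" "continuous_on UNIV j" "\<And>g h. j (g + h) = j g + j h"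
  shows "(\<lambda>g. b (j g)) \<in> crossed_homs (\<lambda>g. \<rho> (j g)) V"
  using crossed_homD[OF assms(1)] assms(2,3)
  by (auto simp: crossed_homs_def intro: continuous_on_compose2)

lemma approx_principal_compose:
  fixes j :: "'k::topological_group_add \<Rightarrow> 'g::topological_group_add"
  assumes "approx_principal \<rho> V b" "continuous_on UNIV j"
  shows "approx_principal (\<lambda>g. \<rho> (j g)) V (\<lambda>g. b (j g))"
  unfolding approx_principal_def
proof (intro allI impI)
  fix K :: "'k set" and e :: real
  assume "compact K \<and> 0 < e"
  then have "compact (j ` K)" "e > 0"
    using assms(2) by (auto intro: compact_continuous_image continuous_on_subset)
  then show "\<exists>v\<in>V. \<forall>g\<in>K. norm (b (j g) - (\<rho> (j g) v - v)) < e"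
    using assms(1) unfolding approx_principal_def by (metis imageI)
qed

text \<open>
  By commutativity the projection of \<open>b (i g)\<close> to the vectors fixed by \<open>i\<close> is fixed by \<open>j\<close> as
  well, and it is orthogonal to all \<open>\<rho> (i g) v - v\<close>.
\<close>

lemma proj_fixed_vectors_crossed_hom_eq_0:
  assumes M_def: "M = fixed_vectors (\<lambda>g. \<rho> (i g))"
    and N_def: "N = fixed_vectors (\<lambda>k. \<rho> (j k))"
    and "invariant_subspace \<rho> M" "invariant_subspace \<rho> N"
    and commute: "\<And>g k. i g + j k = j k + i g"
    and b: "b \<in> crossed_homs \<rho> UNIV"
    and approx: "approx_principal (\<lambda>g. \<rho> (i g)) N (\<lambda>g. invariant_subspace.proj N (b (i g)))"
  shows "invariant_subspace.proj M (b (i g)) = 0"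
proof -
  interpret M: invariant_subspace \<rho> M by fact
  interpret N: invariant_subspace \<rho> N by fact
  define c where "c = M.proj (b (i g))"
  have fixM: "\<rho> (i h) (M.proj x) = M.proj x" for h x
    using M.proj_mem[of x] by (simp add: M_def fixed_vectors_def)
  have "\<rho> (j k) c = c" for k
  proof -
    \<comment> \<open>Both sides are \<open>b\<close> of the same product, taken in two orders.
      After projection to \<open>M\<close> the term \<open>M.proj (b (j k))\<close> occurs on both
      sides and cancels.\<close>
    have "b (i g) + \<rho> (i g) (b (j k)) = b (j k) + \<rho> (j k) (b (i g))"
      using commute[of g k] crossed_homD(3)[OF b, of "i g" "j k"]
        crossed_homD(3)[OF b, of "j k" "i g"] by simp
    then have "M.proj (b (i g)) + M.proj (\<rho> (i g) (b (j k)))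
        = M.proj (b (j k)) + M.proj (\<rho> (j k) (b (i g)))"
      by (simp flip: M.proj_add)
    then show ?thesis by (simp add: c_def M.proj_rep fixM add.commute)
  qed
  then have cN: "c \<in> N" by (simp add: N_def fixed_vectors_def)
  \<comment> \<open>Pairing with \<open>c\<close> kills \<open>\<rho> (i g) v - v\<close>, as
    \<open>c\<close> is fixed, and replaces \<open>b (i g)\<close> by
    \<open>N.proj (b (i g))\<close>, as \<open>c \<in> N\<close>. Approximation on the one-point set
    containing \<open>g\<close> suffices.\<close>
  have "norm c \<le> e" if e: "e > 0" for e
  proof -
    obtain v where v: "norm (N.proj (b (i g)) - (\<rho> (i g) v - v)) < e"
      using approx e unfolding approx_principal_def
      by (metis compact_sing singletonI)
    have "inner (\<rho> (i g) v) c = inner v c"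
      using M.inner[of "i g" v c] fixM[of g "b (i g)"] by (simp add: c_def)
    moreover have "inner (b (i g)) c = inner c c"
      using M.proj_orth[of c "b (i g)"] M.proj_mem[of "b (i g)"] by (simp add: c_def inner_diff_left)
    moreover have "inner (b (i g)) c = inner (N.proj (b (i g))) c"
      using N.proj_orth[OF cN, of "b (i g)"] by (simp add: inner_diff_left)
    ultimately have "inner c c = inner (N.proj (b (i g)) - (\<rho> (i g) v - v)) c"
      by (simp add: inner_diff_left)
    also have "\<dots> \<le> norm (N.proj (b (i g)) - (\<rho> (i g) v - v)) * norm c"
      by (rule norm_cauchy_schwarz)
    also have "\<dots> \<le> e * norm c" using v by (intro mult_right_mono) auto
    finally show ?thesis
      by (cases "c = 0") (use e in \<open>auto simp: dot_square_norm power2_eq_square\<close>)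
  qed
  then have "norm c \<le> 0" by (rule field_le_epsilon) simp
  then show ?thesis by (simp add: c_def)
qed

text \<open>The projection \<open>N.proj\<close> commutes with \<open>\<rho>\<close>, so it maps
  \<open>M\<close> into itself. Being self-adjoint, it can be moved onto \<open>m\<close>, and the
  result is orthogonal to \<open>x\<close>. Thus removing a component in \<open>N\<close> does not
  create one in \<open>M\<close>.\<close>

lemma proj_proj_orthogonal:
  assumes M_def: "M = fixed_vectors (\<lambda>g. \<rho> (i g))"
    and "invariant_subspace \<rho> M" "invariant_subspace \<rho> N"
    and "invariant_subspace.proj M x = 0" and m: "m \<in> M"
  shows "inner (invariant_subspace.proj N x) m = 0"
proof -
  interpret M: invariant_subspace \<rho> M by fact
  interpret N: invariant_subspace \<rho> N by fact
  have "N.proj m \<in> M" using m by (auto simp: M_def fixed_vectors_def simp flip: N.proj_rep)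
  then have "inner x (N.proj m) = 0"
    using M.proj_orth[of "N.proj m" x] assms(4) by simp
  moreover have "inner (N.proj x) m = inner (N.proj x) (N.proj m)"
    using N.proj_orth[OF N.proj_mem, of m x]
    by (metis eq_iff_diff_eq_0 inner_commute inner_diff_left)
  moreover have "inner x (N.proj m) = inner (N.proj x) (N.proj m)"
    using N.proj_orth[OF N.proj_mem, of x m] by (simp add: inner_diff_left)
  ultimately show ?thesis by simp
qed

text \<open>This computes the kernel of the map to the direct sum. Projections are contractions that
  commute with \<open>\<rho>\<close>, which gives one direction. For the other, \<open>b\<close> is
  the sum of its two projections and a remainder \<open>q\<close> to which the orthogonal case
  applies; the three parts are approximated separately.\<close>

lemma product_approx_principal_iff:
  fixes \<rho> :: "'g1::topological_group_add \<times> 'g2::topological_group_add \<Rightarrow>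
                'h::complex_hilbert_space \<Rightarrow> 'h"
  defines "\<rho>1 \<equiv> \<lambda>g. \<rho> (g, 0)" and "\<rho>2 \<equiv> \<lambda>g. \<rho> (0, g)"
  defines "P1 \<equiv> invariant_subspace.proj (fixed_vectors \<rho>1)"
    and "P2 \<equiv> invariant_subspace.proj (fixed_vectors \<rho>2)"
  assumes rep: "unitary_rep \<rho>" and b: "b \<in> crossed_homs \<rho> UNIV"
  shows "approx_principal \<rho> UNIV b \<longleftrightarrow>
           approx_principal \<rho>1 (fixed_vectors \<rho>2) (\<lambda>g. P2 (b (g, 0))) \<and>
           approx_principal \<rho>2 (fixed_vectors \<rho>1) (\<lambda>g. P1 (b (0, g)))"
    (is "?L \<longleftrightarrow> ?R1 \<and> ?R2")
proof
  interpret S1: invariant_subspace \<rho> "fixed_vectors \<rho>1"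
    unfolding \<rho>1_def by (rule invariant_subspace_fixed_vectors_factors[OF rep])
  interpret S2: invariant_subspace \<rho> "fixed_vectors \<rho>2"
    unfolding \<rho>2_def by (rule invariant_subspace_fixed_vectors_factors[OF rep])
  show "?R1 \<and> ?R2" if ?L
    unfolding P1_def P2_def
    using approx_principal_compose[OF S2.proj_approx_principal[OF that], of "\<lambda>g. (g, 0)"]
      approx_principal_compose[OF S1.proj_approx_principal[OF that], of "\<lambda>g. (0, g)"]
    by (simp add: \<rho>1_def \<rho>2_def continuous_on_Pair)
  assume R: "?R1 \<and> ?R2"
  have M1: "fixed_vectors \<rho>1 = fixed_vectors (\<lambda>g. \<rho> (g, 0))"
    and M2: "fixed_vectors \<rho>2 = fixed_vectors (\<lambda>g. \<rho> (0, g))"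
    by (simp_all only: \<rho>1_def \<rho>2_def)
  have P1_0: "P1 (b (g, 0)) = 0" for g
    unfolding P1_def
    by (rule proj_fixed_vectors_crossed_hom_eq_0[where \<rho> = \<rho> and b = b and i = "\<lambda>g. (g, 0)" and j = "\<lambda>k. (0, k)",
          OF M1 M2
          S1.invariant_subspace_axioms S2.invariant_subspace_axioms _ b
          R[THEN conjunct1, unfolded P2_def, unfolded \<rho>1_def]]) simp
  have P2_0: "P2 (b (0, g)) = 0" for g
    unfolding P2_def
    by (rule proj_fixed_vectors_crossed_hom_eq_0[where \<rho> = \<rho> and b = b and i = "\<lambda>k. (0, k)" and j = "\<lambda>g. (g, 0)",
          OF M2 M1
          S2.invariant_subspace_axioms S1.invariant_subspace_axioms _ b
          R[THEN conjunct2, unfolded P1_def, unfolded \<rho>2_def]]) simp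
  have b_split: "b (g, k) = b (g, 0) + \<rho> (g, 0) (b (0, k))"
    "b (g, k) = b (0, k) + \<rho> (0, k) (b (g, 0))" for g k
    by (simp_all flip: crossed_homD(3)[OF b])
  \<comment> \<open>Vanishing of \<open>P1 b\<close> on the first factor and invariance of its
    values under that factor leave a function of the second coordinate only.\<close>
  have P1_b: "P1 (b (g, k)) = P1 (b (0, k))" for g k
  proof -
    have "P1 (b (g, k)) = \<rho> (g, 0) (P1 (b (0, k)))"
      using P1_0 S1.proj_add by (simp add: b_split(1)[of g k] P1_def S1.proj_rep)
    then show ?thesis
      using S1.proj_mem[of "b (0, k)"] by (simp add: P1_def \<rho>1_def fixed_vectors_def)
  qed
  have P2_b: "P2 (b (g, k)) = P2 (b (g, 0))" for g k
  proof -
    have "P2 (b (g, k)) = \<rho> (0, k) (P2 (b (g, 0)))"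
      using P2_0 S2.proj_add by (simp add: b_split(2)[of g k] P2_def S2.proj_rep)
    then show ?thesis
      using S2.proj_mem[of "b (g, 0)"] by (simp add: P2_def \<rho>2_def fixed_vectors_def)
  qed
  \<comment> \<open>Subtracting both projections does not subtract anything twice: by
    \<open>P1_0\<close> and \<open>P2_0\<close>, each removed part is orthogonal to the fixed space
    of the other.\<close>
  define q where "q g = b g - P1 (b g) - P2 (b g)" for g
  have q: "q \<in> crossed_homs \<rho> UNIV"
    using crossed_homD[OF b] unfolding q_def P1_def P2_def
    by (auto simp: crossed_homs_def S1.proj_add S2.proj_add S1.proj_rep S2.proj_rep
        S1.diff S1.add intro!: continuous_intros S1.proj_continuous_on S2.proj_continuous_on)
  have orth1: "inner (q x) m = 0" if m: "m \<in> fixed_vectors \<rho>1" for x m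
  proof (cases x)
    case (Pair g k)
    have "inner (P2 (b (g, 0))) m = 0"
      unfolding P2_def
      by (rule proj_proj_orthogonal[where \<rho> = \<rho> and i = "\<lambda>g. (g, 0)", OF M1
            S1.invariant_subspace_axioms S2.invariant_subspace_axioms P1_0[unfolded P1_def] m])
    then show ?thesis
      using S1.proj_orth[OF m, of "b x"] P2_b[of g k] Pair
      by (simp add: q_def inner_diff_left P1_def)
  qed
  have orth2: "inner (q x) m = 0" if m: "m \<in> fixed_vectors \<rho>2" for x m
  proof (cases x)
    case (Pair g k)
    have "inner (P1 (b (0, k))) m = 0"
      unfolding P1_def
      by (rule proj_proj_orthogonal[where \<rho> = \<rho> and i = "\<lambda>g. (0, g)", OF M2
            S2.invariant_subspace_axioms S1.invariant_subspace_axioms P2_0[unfolded P2_def] m])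
    then show ?thesis
      using S2.proj_orth[OF m, of "b x"] P1_b[of g k] Pair
      by (simp add: q_def inner_diff_left P2_def)
  qed
  have approx_q: "approx_principal \<rho> UNIV q"
    by (rule product_approx_principal_if_orthogonal[OF rep q])
      (use orth1 orth2 in \<open>auto simp: \<rho>1_def \<rho>2_def\<close>)
  show ?L
    unfolding approx_principal_def
  proof (intro allI impI)
    fix K :: "('g1 \<times> 'g2) set" and e :: real
    assume Ke: "compact K \<and> 0 < e"
    then have K: "compact K" "compact (fst ` K)" "compact (snd ` K)" and e: "e / 3 > 0"
      by (auto intro!: compact_continuous_image continuous_intros)
    obtain w where w: "\<And>x. x \<in> K \<Longrightarrow> norm (q x - (\<rho> x w - w)) < e / 3"
      using approx_q K e unfolding approx_principal_def by meson
    obtain v1 where v1: "v1 \<in> fixed_vectors \<rho>2"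
      "\<And>g. g \<in> fst ` K \<Longrightarrow> norm (P2 (b (g, 0)) - (\<rho>1 g v1 - v1)) < e / 3"
      using R K e unfolding approx_principal_def by meson
    obtain v2 where v2: "v2 \<in> fixed_vectors \<rho>1"
      "\<And>g. g \<in> snd ` K \<Longrightarrow> norm (P1 (b (0, g)) - (\<rho>2 g v2 - v2)) < e / 3"
      using R K e unfolding approx_principal_def by meson
    \<comment> \<open>Because \<open>v1\<close> is fixed by the second factor and \<open>v2\<close>
      by the first, their principal crossed homomorphisms depend on one coordinate each, like the
      parts of \<open>b\<close> that they approximate.\<close>
    have "norm (b x - (\<rho> x (w + v1 + v2) - (w + v1 + v2))) < e" if x: "x \<in> K" for x
    proof (cases x)
      case (Pair g k)
      have "g \<in> fst ` K" "k \<in> snd ` K" using x Pair by force+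
      note small = w[OF x] v1(2)[OF this(1)] v2(2)[OF this(2)]
      have "\<rho> x v1 = \<rho>1 g v1"
        using v1(1) S1.plus[of "(g, 0)" "(0, k)" v1] Pair
        by (simp add: fixed_vectors_def \<rho>1_def \<rho>2_def)
      moreover have "\<rho> x v2 = \<rho>2 k v2"
        using v2(1) S1.plus[of "(0, k)" "(g, 0)" v2] Pair
        by (simp add: fixed_vectors_def \<rho>1_def \<rho>2_def)
      moreover have "b x = q x + P2 (b (g, 0)) + P1 (b (0, k))"
        using P1_b[of g k] P2_b[of g k] Pair by (simp add: q_def)
      ultimately have "b x - (\<rho> x (w + v1 + v2) - (w + v1 + v2)) =
          (q x - (\<rho> x w - w)) + ((P2 (b (g, 0)) - (\<rho>1 g v1 - v1)) + (P1 (b (0, k)) - (\<rho>2 k v2 - v2)))"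
        by (simp add: S1.add)
      also have "norm \<dots> < e"
        using small
          norm_triangle_ineq[of "q x - (\<rho> x w - w)"
            "(P2 (b (g, 0)) - (\<rho>1 g v1 - v1)) + (P1 (b (0, k)) - (\<rho>2 k v2 - v2))"]
          norm_triangle_ineq[of "P2 (b (g, 0)) - (\<rho>1 g v1 - v1)" "P1 (b (0, k)) - (\<rho>2 k v2 - v2)"]
        by linarith
      finally show ?thesis .
    qed
    then show "\<exists>v\<in>UNIV. \<forall>x\<in>K. norm (b x - (\<rho> x v - v)) < e" by blast
  qed
qed

text \<open>The values of \<open>b1\<close> are fixed by the second factor, so
  \<open>\<rho> x\<close> acts on them through \<open>fst x\<close> alone, and symmetrically for
  \<open>b2\<close>. Each summand is therefore a crossed homomorphism of the product.\<close>

lemma product_crossed_hom: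
  fixes \<rho> :: "'g1::topological_group_add \<times> 'g2::topological_group_add \<Rightarrow>
                'h::complex_hilbert_space \<Rightarrow> 'h"
  assumes rep: "unitary_rep \<rho>"
    and b1: "b1 \<in> crossed_homs (\<lambda>g. \<rho> (g, 0)) (fixed_vectors (\<lambda>g. \<rho> (0, g)))"
    and b2: "b2 \<in> crossed_homs (\<lambda>g. \<rho> (0, g)) (fixed_vectors (\<lambda>g. \<rho> (g, 0)))"
  shows "(\<lambda>x. b1 (fst x) + b2 (snd x)) \<in> crossed_homs \<rho> UNIV"
proof -
  interpret unitary_rep \<rho> by fact
  have fixed: "\<rho> (0, k) (b1 g) = b1 g" "\<rho> (g, 0) (b2 k) = b2 k" for g k
    using crossed_homD(2)[OF b1] crossed_homD(2)[OF b2] by (auto simp: fixed_vectors_def)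
  have act: "\<rho> x (b1 h) = \<rho> (fst x, 0) (b1 h)" "\<rho> x (b2 l) = \<rho> (0, snd x) (b2 l)" for x h l
    using plus[of "(fst x, 0)" "(0, snd x)" "b1 h"] plus[of "(0, snd x)" "(fst x, 0)" "b2 l"]
    by (simp_all add: fixed)
  have "continuous_on UNIV (\<lambda>x. b1 (fst x) + b2 (snd x))"
    by (intro continuous_intros continuous_on_compose2[OF crossed_homD(1)[OF b1, of UNIV]]
        continuous_on_compose2[OF crossed_homD(1)[OF b2, of UNIV]]) auto
  moreover have "b1 (fst (x + y)) + b2 (snd (x + y)) =
      b1 (fst x) + b2 (snd x) + \<rho> x (b1 (fst y) + b2 (snd y))" for x y
    using act(1)[of x "fst y"] act(2)[of x "snd y"]
    by (simp add: add crossed_homD(3)[OF b1] crossed_homD(3)[OF b2])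
  ultimately show ?thesis by (simp add: crossed_homs_def del: split_paired_All)
qed

section \<open>Closures in the compact-open topology\<close>

lemma topspace_compact_open_topology: "topspace (compact_open_topology X Y) = continuous_maps X Y"
proof -
  have "\<Union> {{f \<in> continuous_maps X Y. f ` K \<subseteq> U} |K U. compactin X K \<and> openin Y U}
      = continuous_maps X Y"
    \<comment> \<open>The empty compact set imposes no condition, so the whole space is a subbasic
      set.\<close>
    by (auto intro!: exI[of _ "{}"])
  then show ?thesis
    unfolding compact_open_topology_def topology_generated_by_topspace .
qed

lemma compact_image_continuous_maps:
  assumes "c \<in> continuous_maps X (top_of_set V)" "compactin X K"
  shows "compact (c ` K)"
  using assms image_compactin[of X K "top_of_set V" c]
  by (auto simp: continuous_maps_def compactin_subtopology)

lemma compact_open_basic_nbhd: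
  fixes V :: "'v::metric_space set"
  assumes "openin (compact_open_topology X (top_of_set V)) W" "c \<in> W"
  shows "\<exists>K e. compactin X K \<and> e > 0 \<and>
           {d \<in> continuous_maps X (top_of_set V). \<forall>x\<in>K. dist (c x) (d x) < e} \<subseteq> W"
proof -
  let ?B = "\<lambda>K e. {d \<in> continuous_maps X (top_of_set V). \<forall>x\<in>K. dist (c x) (d x) < e}"
  have "generate_topology_on
      {{f \<in> continuous_maps X (top_of_set V). f ` K \<subseteq> U} |K U.
        compactin X K \<and> openin (top_of_set V) U} W"
    using assms(1) unfolding compact_open_topology_def by (rule openin_topology_generated_by)
  then show ?thesis using assms(2)
  proof (induction rule: generate_topology_on.induct)
    case (Int A B)
    then obtain K e L d where "compactin X K" "e > 0" "?B K e \<subseteq> A" "compactin X L" "d > 0" "?B L d \<subseteq> B"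
      by auto
    then have "compactin X (K \<union> L)" "min e d > 0" "?B (K \<union> L) (min e d) \<subseteq> A \<inter> B"
      by (auto intro: compactin_Un)
    then show ?case by blast
  next
    case (UN \<K>)
    then obtain A where A: "A \<in> \<K>" "c \<in> A" by blast
    then obtain K e where "compactin X K" "e > 0" "?B K e \<subseteq> A" using UN.IH by blast
    moreover have "A \<subseteq> \<Union>\<K>" using A by blast
    ultimately show ?case by (meson order_trans)
  next
    case (Basis S)
    then obtain K U where S: "S = {f \<in> continuous_maps X (top_of_set V). f ` K \<subseteq> U}"
      and K: "compactin X K" and U: "openin (top_of_set V) U"
      by blast
    obtain T where T: "open T" "U = V \<inter> T" using U by (auto simp: openin_open)
    have "compact (c ` K)" "c ` K \<subseteq> T"
      using Basis S K T by (auto intro: compact_image_continuous_maps)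
    then obtain e where e: "e > 0" "(\<Union>y\<in>c ` K. ball y e) \<subseteq> T"
      using compact_subset_open_imp_ball_epsilon_subset T(1) by metis
    have "?B K e \<subseteq> S"
    proof
      fix d assume d: "d \<in> ?B K e"
      have "d x \<in> U" if "x \<in> K" for x
      proof -
        have "x \<in> topspace X" using K that compactin_subset_topspace by blast
        then have "d x \<in> V" using d by (auto simp: continuous_maps_def continuous_map_in_subtopology)
        moreover have "d x \<in> ball (c x) e" using d that by simp
        then have "d x \<in> T" using e that by blast
        ultimately show ?thesis by (simp add: T)
      qed
      then show "d \<in> S" using d S by auto
    qed
    then show ?case using K e by blast
  qed auto
qed

text \<open>
  The sets \<open>c -` cball (c t) (e/3)\<close> with finitely many \<open>t\<close> cover \<open>K\<close> and meet it in compact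
  sets, although \<open>X\<close> need not be Hausdorff.
\<close>

lemma compact_open_ball_nbhd:
  fixes V :: "'v::metric_space set"
  assumes c: "c \<in> continuous_maps X (top_of_set V)" and K: "compactin X K" and e: "e > 0"
  shows "\<exists>W. openin (compact_open_topology X (top_of_set V)) W \<and> c \<in> W \<and>
           (\<forall>d\<in>W. \<forall>x\<in>K. dist (c x) (d x) < e)"
proof -
  have KX: "K \<subseteq> topspace X" using K compactin_subset_topspace by blast
  have cont: "continuous_map X euclidean c" and cV: "\<And>x. x \<in> topspace X \<Longrightarrow> c x \<in> V"
    using c by (auto simp: continuous_maps_def continuous_map_in_subtopology)
  obtain T where T: "finite T" "T \<subseteq> K" "c ` K \<subseteq> (\<Union>t\<in>T. ball (c t) (e / 3))"
    using compactE_image[OF compact_image_continuous_maps[OF c K], of K "\<lambda>t. ball (c t) (e / 3)"] e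
    by (smt (verit, best) UN_I centre_in_ball divide_pos_pos image_subset_iff open_ball)
  \<comment> \<open>Closed balls make \<open>L t\<close> compact, the open balls in
    \<open>S t\<close> give open sets of maps, and the radii satisfy
    \<open>e / 3 + e / 2 < e\<close>.\<close>
  define L where "L t = {x \<in> topspace X. c x \<in> cball (c t) (e / 3)} \<inter> K" for t
  define S where "S t = {f \<in> continuous_maps X (top_of_set V). f ` L t \<subseteq> V \<inter> ball (c t) (e / 2)}" for t
  let ?top = "compact_open_topology X (top_of_set V)"
  have Lc: "compactin X (L t)" for t
    unfolding L_def
    by (intro closed_Int_compactin closedin_continuous_map_preimage[OF cont] K) simp
  have "openin ?top (S t)" for t
    unfolding compact_open_topology_def S_def
    by (rule topology_generated_by_Basis) (use Lc in blast)
  \<comment> \<open>The factor \<open>topspace ?top\<close> covers the case that \<open>T\<close> is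
    empty.\<close>
  then have "openin ?top (topspace ?top \<inter> \<Inter> (S ` T))"
    using T(1) by (intro openin_Int_Inter) auto
  moreover have "c \<in> S t" for t
    using c e cV by (auto simp: S_def L_def)
  moreover have "dist (c x) (d x) < e" if d: "d \<in> topspace ?top \<inter> \<Inter> (S ` T)" and x: "x \<in> K" for d x
  proof -
    obtain t where t: "t \<in> T" "dist (c t) (c x) < e / 3" using T x by fastforce
    then have "x \<in> L t" using x KX by (auto simp: L_def)
    moreover have "d \<in> S t" using d t by blast
    ultimately have "d x \<in> ball (c t) (e / 2)" by (auto simp: S_def)
    then have "dist (c t) (d x) < e / 2" by simp
    then show ?thesis using t dist_triangle3[of "c x" "d x" "c t"] e by linarith
  qed
  ultimately show ?thesis
    using c by (intro exI[of _ "topspace ?top \<inter> \<Inter> (S ` T)"])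
      (auto simp: topspace_compact_open_topology)
qed

lemma compact_open_closure_of:
  fixes V :: "'v::metric_space set"
  assumes "C \<subseteq> continuous_maps X (top_of_set V)" "S \<subseteq> C"
  shows "subtopology (compact_open_topology X (top_of_set V)) C closure_of S =
           {c \<in> C. \<forall>K e. compactin X K \<and> e > 0 \<longrightarrow> (\<exists>d\<in>S. \<forall>x\<in>K. dist (c x) (d x) < e)}"
    (is "?L = ?R")
proof -
  have CS: "C \<inter> S = S" using assms by blast
  have "c \<in> ?R" if c: "c \<in> ?L" for c
  proof -
    have cC: "c \<in> C" "c \<in> continuous_maps X (top_of_set V)"
      using c assms by (auto simp: closure_of_subtopology)
    have "\<exists>d\<in>S. \<forall>x\<in>K. dist (c x) (d x) < e" if Ke: "compactin X K" "e > 0" for K e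
    proof -
      obtain W where "openin (compact_open_topology X (top_of_set V)) W" "c \<in> W"
        "\<And>d. d \<in> W \<Longrightarrow> \<forall>x\<in>K. dist (c x) (d x) < e"
        using compact_open_ball_nbhd[OF cC(2) Ke] by blast
      moreover from this obtain d where "d \<in> S" "d \<in> W"
        using c by (auto simp: closure_of_subtopology CS in_closure_of)
      ultimately show ?thesis by blast
    qed
    then show ?thesis using cC by blast
  qed
  moreover have "c \<in> ?L" if c: "c \<in> ?R" for c
  proof -
    have "\<exists>d. d \<in> S \<and> d \<in> W" if W: "openin (compact_open_topology X (top_of_set V)) W" "c \<in> W" for W
    proof -
      obtain K e where Ke: "compactin X K" "e > 0"
        "{d \<in> continuous_maps X (top_of_set V). \<forall>x\<in>K. dist (c x) (d x) < e} \<subseteq> W"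
        using compact_open_basic_nbhd[OF W] by blast
      then obtain d where "d \<in> S" "\<forall>x\<in>K. dist (c x) (d x) < e" using c by blast
      then show ?thesis using Ke assms by blast
    qed
    then show ?thesis
      using c assms by (auto simp: closure_of_subtopology CS in_closure_of topspace_compact_open_topology)
  qed
  ultimately show ?thesis by blast
qed

section \<open>Degree one cocycles\<close>

text \<open>For a crossed homomorphism this is the usual homogeneous cocycle
  \<open>\<rho> (x 0) (b (- x 0 + x 1))\<close>; written as a difference, it does not mention
  \<open>\<rho>\<close>.\<close>

definition homogenize :: "('g \<Rightarrow> 'v::ab_group_add) \<Rightarrow> (nat \<Rightarrow> 'g::topological_space) \<Rightarrow> 'v"
  where "homogenize b = (\<lambda>x\<in>topspace (power_top 2). b (x 1) - b (x 0))"

definition pair_args :: "'g \<Rightarrow> 'g \<Rightarrow> nat \<Rightarrow> 'g"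
  where "pair_args a b = (\<lambda>i\<in>{..<2}. if i = 0 then a else b)"

lemma topspace_power_top: "topspace (power_top m) = extensional {..<m}"
  by (auto simp: power_top_def PiE_def)

lemma pair_args_mem [simp]: "pair_args a b \<in> topspace (power_top 2)"
  by (simp add: topspace_power_top pair_args_def)

lemma pair_args_simps [simp]: "pair_args a b 0 = a" "pair_args a b (Suc 0) = b" "pair_args a b 1 = b"
  by (simp_all add: pair_args_def)

lemma pair_args_eta: "x \<in> topspace (power_top 2) \<Longrightarrow> pair_args (x 0) (x 1) = x"
  by (auto simp: topspace_power_top pair_args_def extensional_def less_2_cases_iff)

lemma homogenize_apply: "x \<in> topspace (power_top 2) \<Longrightarrow> homogenize b x = b (x 1) - b (x 0)"
  by (simp add: homogenize_def)

lemma homogenize_pair_args [simp]: "homogenize b (pair_args g h) = b h - b g"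
  by (simp add: homogenize_apply)

lemma continuous_map_power_top_proj: "i < m \<Longrightarrow> continuous_map (power_top m) euclidean (\<lambda>x. x i)"
  unfolding power_top_def by (rule continuous_map_product_projection) simp

lemma continuous_map_pair_args: "continuous_map euclidean (power_top 2) (pair_args a)"
  unfolding power_top_def pair_args_def
  by (auto simp: continuous_map_componentwise intro!: continuous_intros)

lemma coboundary_1_apply:
  assumes "x \<in> topspace (power_top 3)"
  shows "coboundary 1 c x = c (pair_args (x 1) (x 2)) - c (pair_args (x 0) (x 2)) + c (pair_args (x 0) (x 1))"
proof -
  have "omit_coord 2 0 x = pair_args (x 1) (x 2)" "omit_coord 2 1 x = pair_args (x 0) (x 2)"
    "omit_coord 2 2 x = pair_args (x 0) (x 1)"
    by (auto simp: omit_coord_def pair_args_def fun_eq_iff less_2_cases_iff restrict_def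
        simp flip: numeral_2_eq_2)
  then show ?thesis
    using assms by (simp add: coboundary_def eval_nat_numeral)
qed

lemma coboundary_0_apply:
  assumes "x \<in> topspace (power_top 2)"
  shows "coboundary 0 c x = c (\<lambda>i\<in>{..<1}. x 1) - c (\<lambda>i\<in>{..<1}. x 0)"
proof -
  have "omit_coord 1 0 x = (\<lambda>i\<in>{..<1}. x 1)" "omit_coord 1 1 x = (\<lambda>i\<in>{..<1}. x 0)"
    by (auto simp: omit_coord_def fun_eq_iff restrict_def)
  then show ?thesis
    using assms by (simp add: coboundary_def eval_nat_numeral)
qed

lemma cochain_space_simps [simp]:
  "carrier (cochain_space \<rho> V n) =
     {c \<in> continuous_maps (power_top (Suc n)) (top_of_set V).
       \<forall>g. \<forall>x\<in>topspace (power_top (Suc n)). c (\<lambda>i\<in>{..<Suc n}. g + x i) = \<rho> g (c x)}"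
  "\<zero>\<^bsub>cochain_space \<rho> V n\<^esub> = (\<lambda>x\<in>topspace (power_top (Suc n)). 0)"
  "c \<oplus>\<^bsub>cochain_space \<rho> V n\<^esub> d = (\<lambda>x\<in>topspace (power_top (Suc n)). c x + d x)"
  "a \<odot>\<^bsub>cochain_space \<rho> V n\<^esub> c = (\<lambda>x\<in>topspace (power_top (Suc n)). a *\<^sub>C c x)"
  by (simp_all add: cochain_space_def Let_def)

lemma translate_power_top: "(\<lambda>i\<in>{..<m}. g + x i) \<in> topspace (power_top m)"
  by (simp add: topspace_power_top)

context invariant_subspace
begin

lemma homogenize_cochain:
  assumes "b \<in> crossed_homs \<rho> M"
  shows "homogenize b \<in> carrier (cochain_space \<rho> M 1)"
proof -
  have cont: "continuous_map (power_top 2) euclidean (\<lambda>x. b (x i))" if "i < 2" for i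
    using continuous_map_compose[OF continuous_map_power_top_proj[OF that], of euclidean b]
      crossed_homD(1)[OF assms, of UNIV] by (simp add: o_def)
  have "continuous_map (power_top 2) euclidean (\<lambda>x. b (x 1) - b (x 0))"
    by (intro continuous_map_diff cont) auto
  then have "continuous_map (power_top 2) euclidean (homogenize b)"
    by (rule continuous_map_eq) (simp add: homogenize_apply)
  moreover have "homogenize b x \<in> M" if "x \<in> topspace (power_top 2)" for x
    using that crossed_homD(2)[OF assms] by (simp add: homogenize_apply M_diff)
  moreover have "homogenize b (\<lambda>i\<in>{..<2}. g + x i) = \<rho> g (homogenize b x)"
    if "x \<in> topspace (power_top 2)" for g x
    using that
    by (simp add: homogenize_apply translate_power_top crossed_homD(3)[OF assms] diff)
  moreover have "homogenize b \<in> extensional (topspace (power_top 2))"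
    by (simp add: homogenize_def)
  ultimately show ?thesis
    by (simp add: continuous_maps_def continuous_map_in_subtopology Pi_iff numeral_2_eq_2)
qed

text \<open>The inverse of \<open>homogenize\<close> is evaluation at \<open>pair_args 0 g\<close>:
  the cocycle identity for triples starting with \<open>0\<close> recovers \<open>c\<close> as a
  difference, and equivariance supplies the factor \<open>\<rho> g\<close> in the crossed
  homomorphism law.\<close>

lemma cocycles_1: "cocycles \<rho> M 1 = homogenize ` crossed_homs \<rho> M"
proof (intro equalityI subsetI)
  fix c assume "c \<in> cocycles \<rho> M 1"
  then have c: "c \<in> carrier (cochain_space \<rho> M 1)"
    and d0: "coboundary 1 c = \<zero>\<^bsub>cochain_space \<rho> M 2\<^esub>"
    unfolding cocycles_def by (auto simp flip: numeral_2_eq_2)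
  have cext: "c \<in> extensional (topspace (power_top 2))"
    and ccont: "continuous_map (power_top 2) euclidean c"
    and cM: "\<And>x. x \<in> topspace (power_top 2) \<Longrightarrow> c x \<in> M"
    and cequiv: "\<And>g x. x \<in> topspace (power_top 2) \<Longrightarrow> c (\<lambda>i\<in>{..<2}. g + x i) = \<rho> g (c x)"
    using c by (auto simp: continuous_maps_def continuous_map_in_subtopology Pi_iff numeral_2_eq_2)
  have cocycle: "c (pair_args y z) - c (pair_args x z) + c (pair_args x y) = 0" for x y z
  proof -
    define t where "t = (\<lambda>i\<in>{..<3::nat}. if i = 0 then x else if i = 1 then y else z)"
    have t: "t \<in> topspace (power_top 3)" "t 0 = x" "t 1 = y" "t 2 = z"
      by (auto simp: topspace_power_top t_def)
    have "coboundary 1 c t = 0"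
      using t(1) unfolding d0 by (simp add: eval_nat_numeral)
    then show ?thesis using coboundary_1_apply[OF t(1), of c] t by simp
  qed
  define b where "b g = c (pair_args 0 g)" for g
  have "continuous_on UNIV b"
    using continuous_map_compose[OF continuous_map_pair_args ccont, of 0]
    by (simp add: b_def o_def)
  moreover have "b (g + h) = b g + \<rho> g (b h)" for g h
  proof -
    have "(\<lambda>i\<in>{..<2}. g + pair_args 0 h i) = pair_args g (g + h)"
      by (auto simp: pair_args_def fun_eq_iff restrict_def)
    then have "\<rho> g (b h) = c (pair_args g (g + h))"
      using cequiv[OF pair_args_mem, of g 0 h] by (simp add: b_def)
    \<comment> \<open>The triple is \<open>0, g, g + h\<close>: the variables of
      \<open>cocycle\<close> are instantiated in their order of occurrence
      \<open>y, z, x\<close>.\<close>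
    then show ?thesis
      using cocycle[of g "g + h" 0] by (simp add: b_def algebra_simps)
  qed
  ultimately have "b \<in> crossed_homs \<rho> M"
    by (auto simp: crossed_homs_def b_def cM)
  moreover have "c = homogenize b"
  proof (rule extensionalityI[OF cext])
    show "homogenize b \<in> extensional (topspace (power_top 2))"
      by (simp add: homogenize_def)
    show "c x = homogenize b x" if "x \<in> topspace (power_top 2)" for x
      using that cocycle[of "x 0" "x 1" 0] pair_args_eta[OF that]
      by (simp add: homogenize_apply b_def algebra_simps)
  qed
  ultimately show "c \<in> homogenize ` crossed_homs \<rho> M" by blast
next
  fix c assume "c \<in> homogenize ` crossed_homs \<rho> M"
  then obtain b where b: "b \<in> crossed_homs \<rho> M" "c = homogenize b" by blast
  have "coboundary 1 c = (\<lambda>x\<in>topspace (power_top 3). 0)"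
  proof (rule extensionalityI)
    show "coboundary 1 c \<in> extensional (topspace (power_top 3))"
      by (simp add: coboundary_def eval_nat_numeral)
    show "coboundary 1 c x = (\<lambda>x\<in>topspace (power_top 3). 0) x"
      if "x \<in> topspace (power_top 3)" for x
      using that coboundary_1_apply[OF that, of "homogenize b"] by (simp add: b)
  qed simp
  then show "c \<in> cocycles \<rho> M 1"
    unfolding cocycles_def using homogenize_cochain[OF b(1)] b(2)
    by (simp del: cochain_space_simps(1) add: eval_nat_numeral)
qed

text \<open>An equivariant cochain of degree zero is determined by its value \<open>v\<close> at the
  identity, namely as \<open>\<rho> g v\<close>. The constant \<open>- v\<close> cancels in
  \<open>homogenize\<close> and only serves to make the function a crossed homomorphism.\<close>

lemma coboundaries_1: "coboundaries \<rho> M 1 = (\<lambda>v. homogenize (\<lambda>g. \<rho> g v - v)) ` M"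
proof (intro equalityI subsetI)
  fix d assume "d \<in> coboundaries \<rho> M 1"
  then obtain c where c: "c \<in> carrier (cochain_space \<rho> M 0)" and d: "d = coboundary 0 c"
    by auto
  define e :: "nat \<Rightarrow> 'g" where "e = (\<lambda>i\<in>{..<1}. 0)"
  have e: "e \<in> topspace (power_top 1)" by (simp add: e_def topspace_power_top)
  have cM: "c e \<in> M"
    using c e by (auto simp: continuous_maps_def continuous_map_in_subtopology Pi_iff)
  have c_const: "c (\<lambda>i\<in>{..<1}. g) = \<rho> g (c e)" for g
  proof -
    have "(\<lambda>i\<in>{..<1}. g + e i) = (\<lambda>i\<in>{..<1::nat}. g)" by (auto simp: e_def)
    moreover have "c (\<lambda>i\<in>{..<1}. g + e i) = \<rho> g (c e)" using c e by simp
    ultimately show ?thesis by simp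
  qed
  have "d = homogenize (\<lambda>g. \<rho> g (c e) - c e)"
  proof (rule extensionalityI)
    show "d \<in> extensional (topspace (power_top 2))"
      by (simp add: d coboundary_def eval_nat_numeral)
    show "homogenize (\<lambda>g. \<rho> g (c e) - c e) \<in> extensional (topspace (power_top 2))"
      by (simp add: homogenize_def)
    show "d x = homogenize (\<lambda>g. \<rho> g (c e) - c e) x" if "x \<in> topspace (power_top 2)" for x
      using that by (simp only: d coboundary_0_apply c_const homogenize_apply) simp
  qed
  then show "d \<in> (\<lambda>v. homogenize (\<lambda>g. \<rho> g v - v)) ` M" using cM by blast
next
  fix d assume "d \<in> (\<lambda>v. homogenize (\<lambda>g. \<rho> g v - v)) ` M"
  then obtain v where v: "v \<in> M" and d: "d = homogenize (\<lambda>g. \<rho> g v - v)" by blast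
  define c :: "(nat \<Rightarrow> 'g) \<Rightarrow> 'h" where "c = (\<lambda>x\<in>topspace (power_top 1). \<rho> (x 0) v)"
  have "continuous_map (power_top 1) euclidean (\<lambda>x. \<rho> (x 0) v)"
    using continuous_map_compose[OF continuous_map_power_top_proj[of 0 1], of euclidean "\<lambda>g. \<rho> g v"]
      continuous_orbit[of UNIV v] by (simp add: o_def)
  then have "continuous_map (power_top 1) euclidean c"
    by (rule continuous_map_eq) (simp add: c_def)
  then have "c \<in> carrier (cochain_space \<rho> M 0)"
    using v
    by (auto simp: continuous_maps_def continuous_map_in_subtopology c_def M_invariant plus
        translate_power_top)
  moreover have "coboundary 0 c = d"
  proof (rule extensionalityI)
    show "coboundary 0 c \<in> extensional (topspace (power_top 2))"
      by (simp add: coboundary_def eval_nat_numeral)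
    show "d \<in> extensional (topspace (power_top 2))"
      by (simp add: d homogenize_def)
    show "coboundary 0 c x = d x" if "x \<in> topspace (power_top 2)" for x
    proof -
      have "(\<lambda>i\<in>{..<1}. g) \<in> topspace (power_top 1)" for g :: 'g
        by (simp add: topspace_power_top)
      then show ?thesis
        using that by (simp only: d coboundary_0_apply homogenize_apply c_def restrict_apply') simp
    qed
  qed
  ultimately show "d \<in> coboundaries \<rho> M 1"
    by (metis One_nat_def coboundaries.simps(2) image_eqI)
qed

lemma principal_crossed_hom: "v \<in> M \<Longrightarrow> (\<lambda>g. \<rho> g v - v) \<in> crossed_homs \<rho> M"
  by (auto simp: crossed_homs_def plus diff M_diff M_invariant
      intro!: continuous_intros continuous_orbit)

text \<open>Both homogeneous cochains arise by applying the isometry \<open>\<rho> (x 0)\<close> to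
  values at \<open>- x 0 + x 1\<close>. Estimates on compact sets of pairs thus become estimates on
  compact subsets of the group.\<close>

lemma homogenize_principal_dist:
  assumes "b \<in> crossed_homs \<rho> M" "x \<in> topspace (power_top 2)"
  shows "dist (homogenize b x) (homogenize (\<lambda>g. \<rho> g v - v) x) =
           norm (b (- x 0 + x 1) - (\<rho> (- x 0 + x 1) v - v))"
proof -
  have "x 1 = x 0 + (- x 0 + x 1)" by (simp flip: add.assoc)
  then have "b (x 1) = b (x 0) + \<rho> (x 0) (b (- x 0 + x 1))"
    "\<rho> (x 1) v = \<rho> (x 0) (\<rho> (- x 0 + x 1) v)"
    using crossed_homD(3)[OF assms(1), of "x 0" "- x 0 + x 1"] plus[of "x 0" "- x 0 + x 1" v]
    by metis+
  then have "homogenize b x - homogenize (\<lambda>g. \<rho> g v - v) x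
      = \<rho> (x 0) (b (- x 0 + x 1) - (\<rho> (- x 0 + x 1) v - v))"
    using assms(2) by (simp add: homogenize_apply diff)
  then show ?thesis by (simp add: dist_norm)
qed

text \<open>The closure is taken among all cochains, so a limit must first be shown to be a cocycle.
  Compact subsets of the group and of pairs are then exchanged by \<open>pair_args 0\<close> and by
  the map \<open>- x 0 + x 1\<close>.\<close>

lemma closed_coboundaries_1:
  "closed_coboundaries \<rho> M 1 = homogenize ` {b \<in> crossed_homs \<rho> M. approx_principal \<rho> M b}"
proof -
  let ?C = "carrier (cochain_space \<rho> M 1)" and ?S = "coboundaries \<rho> M 1"
  have sub: "?C \<subseteq> continuous_maps (power_top (Suc 1)) (top_of_set M)" "?S \<subseteq> ?C"
    using homogenize_cochain[OF principal_crossed_hom] unfolding coboundaries_1 by auto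
  have eq: "closed_coboundaries \<rho> M 1 = {c \<in> ?C. \<forall>K e. compactin (power_top 2) K \<and> e > 0 \<longrightarrow>
      (\<exists>v\<in>M. \<forall>x\<in>K. dist (c x) (homogenize (\<lambda>g. \<rho> g v - v) x) < e)}"
    unfolding closed_coboundaries_def compact_open_closure_of[OF sub]
    unfolding coboundaries_1 Suc_1 bex_simps ..
  show ?thesis
  proof (intro equalityI subsetI)
    fix c assume c: "c \<in> closed_coboundaries \<rho> M 1"
    have approx: "\<exists>v\<in>M. \<forall>x\<in>K. dist (c x) (homogenize (\<lambda>g. \<rho> g v - v) x) < e"
      if "compactin (power_top 2) K" "e > 0" for K e
      using c that unfolding eq by blast
    have "coboundary 1 c x = 0" if x: "x \<in> topspace (power_top 3)" for x
    proof -
      \<comment> \<open>The value of \<open>coboundary 1 c\<close> at \<open>x\<close> involves only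
        three values of \<open>c\<close>. On this finite, hence compact, set \<open>c\<close> is
        close to a coboundary, whose own three values cancel.\<close>
      let ?K = "{pair_args (x 1) (x 2), pair_args (x 0) (x 2), pair_args (x 0) (x 1)}"
      have "norm (coboundary 1 c x) \<le> e" if e: "e > 0" for e
      proof -
        have "compactin (power_top 2) ?K" "e / 3 > 0"
          using e by (auto intro: finite_imp_compactin)
        from approx[OF this]
        obtain v where v: "\<forall>y\<in>?K. dist (c y) (homogenize (\<lambda>g. \<rho> g v - v) y) < e / 3"
          by blast
        let ?d = "homogenize (\<lambda>g. \<rho> g v - v)"
        let ?r = "\<lambda>y z. c (pair_args y z) - ?d (pair_args y z)"
        have split: "coboundary 1 c x = ?r (x 1) (x 2) - ?r (x 0) (x 2) + ?r (x 0) (x 1)"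
          unfolding coboundary_1_apply[OF x] by simp
        have "norm (coboundary 1 c x)
            \<le> norm (?r (x 1) (x 2)) + norm (?r (x 0) (x 2)) + norm (?r (x 0) (x 1))"
          unfolding split
          using norm_triangle_ineq[of "?r (x 1) (x 2) - ?r (x 0) (x 2)" "?r (x 0) (x 1)"]
            norm_triangle_ineq4[of "?r (x 1) (x 2)" "?r (x 0) (x 2)"] by linarith
        also have "\<dots> \<le> e / 3 + e / 3 + e / 3"
          using v unfolding dist_norm by (intro add_mono) (auto intro: less_imp_le)
        finally show ?thesis by simp
      qed
      then have "norm (coboundary 1 c x) \<le> 0" by (rule field_le_epsilon) simp
      then show ?thesis by simp
    qed
    then have "coboundary 1 c = \<zero>\<^bsub>cochain_space \<rho> M (Suc 1)\<^esub>"
      by (intro extensionalityI[of _ "topspace (power_top 3)"])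
        (auto simp: coboundary_def eval_nat_numeral)
    then have "c \<in> cocycles \<rho> M 1"
      using c unfolding eq cocycles_def by blast
    then obtain b where b: "b \<in> crossed_homs \<rho> M" "c = homogenize b"
      unfolding cocycles_1 by blast
    have "b 0 = 0" using crossed_homD(3)[OF b(1), of 0 0] by simp
    have "approx_principal \<rho> M b"
      unfolding approx_principal_def
    proof (intro allI impI)
      fix K :: "'g set" and e :: real
      assume "compact K \<and> 0 < e"
      then have "compactin (power_top 2) (pair_args 0 ` K)" "e > 0"
        by (auto intro: image_compactin[OF _ continuous_map_pair_args])
      then obtain v where v: "v \<in> M"
        "\<forall>x\<in>pair_args 0 ` K. dist (c x) (homogenize (\<lambda>g. \<rho> g v - v) x) < e"
        using approx by meson
      then have "norm (b g - (\<rho> g v - v)) < e" if "g \<in> K" for g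
        using that \<open>b 0 = 0\<close> by (auto simp: b dist_norm)
      then show "\<exists>v\<in>M. \<forall>g\<in>K. norm (b g - (\<rho> g v - v)) < e" using v by blast
    qed
    then show "c \<in> homogenize ` {b \<in> crossed_homs \<rho> M. approx_principal \<rho> M b}"
      using b by blast
  next
    fix c assume "c \<in> homogenize ` {b \<in> crossed_homs \<rho> M. approx_principal \<rho> M b}"
    then obtain b where b: "b \<in> crossed_homs \<rho> M" "approx_principal \<rho> M b" "c = homogenize b"
      by blast
    have "\<exists>v\<in>M. \<forall>x\<in>K. dist (c x) (homogenize (\<lambda>g. \<rho> g v - v) x) < e"
      if K: "compactin (power_top 2) K" and e: "e > 0" for K :: "(nat \<Rightarrow> 'g) set" and e
    proof -
      have "continuous_map (power_top 2) (prod_topology euclidean euclidean) (\<lambda>x::nat \<Rightarrow> 'g. (x 0, x 1))"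
        by (intro continuous_map_pairedI continuous_map_power_top_proj) auto
      moreover have "continuous_on UNIV (\<lambda>p::'g \<times> 'g. - fst p + snd p)"
        by (intro continuous_intros)
      ultimately have "continuous_map (power_top 2) euclidean (\<lambda>x::nat \<Rightarrow> 'g. - x 0 + x 1)"
        using continuous_map_compose[of "power_top 2" euclidean "\<lambda>x::nat \<Rightarrow> 'g. (x 0, x 1)"
            euclidean "\<lambda>p. - fst p + snd p"]
        by (simp add: o_def)
      then have "compact ((\<lambda>x. - x 0 + x 1) ` K)"
        using image_compactin[OF K] by fastforce
      then obtain v where "v \<in> M" and
        v: "\<forall>g\<in>(\<lambda>x. - x 0 + x 1) ` K. norm (b g - (\<rho> g v - v)) < e"
        using b(2) e unfolding approx_principal_def by meson
      have "dist (c x) (homogenize (\<lambda>g. \<rho> g v - v) x) < e" if "x \<in> K" for x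
        using v that compactin_subset_topspace[OF K] homogenize_principal_dist[OF b(1), of x v]
        by (auto simp: b(3))
      then show ?thesis using \<open>v \<in> M\<close> by blast
    qed
    then show "c \<in> closed_coboundaries \<rho> M 1"
      unfolding eq using homogenize_cochain[OF b(1)] b(3) by blast
  qed
qed

end

section \<open>Quotients of complex vector spaces\<close>

locale complex_quotient = abelian_subgroup N M for N and M :: "(complex, 'b) module" (structure) +
  assumes smult_closed: "x \<in> carrier M \<Longrightarrow> a \<odot> x \<in> carrier M"
    and smult_add: "\<lbrakk>x \<in> carrier M; y \<in> carrier M\<rbrakk> \<Longrightarrow> a \<odot> (x \<oplus> y) = a \<odot> x \<oplus> a \<odot> y"
    and subspace_smult: "n \<in> N \<Longrightarrow> a \<odot> n \<in> N"
begin

lemma coset_eq_iff: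
  assumes "x \<in> carrier M" "y \<in> carrier M"
  shows "N +> x = N +> y \<longleftrightarrow> x \<oplus> \<ominus> y \<in> N"
proof
  show "x \<oplus> \<ominus> y \<in> N" if "N +> x = N +> y"
    using a_rcos_module_imp[OF assms(2)] a_rcos_self[OF assms(1)] that by simp
  show "N +> x = N +> y" if "x \<oplus> \<ominus> y \<in> N"
    using a_repr_independence'[OF a_rcos_module_rev[OF assms(2,1) that] assms(2)] by simp
qed

lemma carrier_quotient_space: "carrier (quotient_space M N) = (\<lambda>x. N +> x) ` carrier M"
  by (auto simp: quotient_space_def A_RCOSETS_def')

lemma add_quotient_space:
  "\<lbrakk>x \<in> carrier M; y \<in> carrier M\<rbrakk>
    \<Longrightarrow> (N +> x) \<oplus>\<^bsub>quotient_space M N\<^esub> (N +> y) = N +> (x \<oplus> y)"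
  by (simp add: quotient_space_def a_rcos_sum)

text \<open>The union that defines the scalar multiple runs over equal cosets, because multiplying
  by \<open>a\<close> keeps differences in \<open>N\<close>.\<close>

lemma smult_quotient_space:
  assumes "x \<in> carrier M"
  shows "a \<odot>\<^bsub>quotient_space M N\<^esub> (N +> x) = N +> (a \<odot> x)"
proof -
  have "N +> (a \<odot> y) = N +> (a \<odot> x)" if "y \<in> N +> x" for y
  proof -
    obtain n where n: "n \<in> N" "y = n \<oplus> x"
      using \<open>y \<in> N +> x\<close> by (auto simp: a_r_coset_def')
    then have "a \<odot> y \<in> N +> (a \<odot> x)"
      using assms subspace_smult[OF n(1), of a] by (auto simp: a_r_coset_def' smult_add)
    then show ?thesis
      using a_repr_independence'[OF _ smult_closed[OF assms]] by simp
  qed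
  then have "(\<Union>y\<in>N +> x. N +> (a \<odot> y)) = N +> (a \<odot> x)"
    using a_rcos_self[OF assms] by blast
  then show ?thesis
    by (simp add: quotient_space_def)
qed

end

text \<open>First isomorphism theorem for the pair of \<open>T1\<close> and \<open>T2\<close>: it is
  onto by \<open>onto\<close>, and \<open>preimage\<close> makes the induced map on cosets well
  defined and injective.\<close>

lemma quotient_isomorphic_direct_sum:
  assumes "complex_quotient N M" "complex_quotient N1 M1" "complex_quotient N2 M2"
    and T1_closed: "\<And>x. x \<in> carrier M \<Longrightarrow> T1 x \<in> carrier M1"
    and T2_closed: "\<And>x. x \<in> carrier M \<Longrightarrow> T2 x \<in> carrier M2"
    and T1_add: "\<And>x y. \<lbrakk>x \<in> carrier M; y \<in> carrier M\<rbrakk> \<Longrightarrow> T1 (x \<oplus>\<^bsub>M\<^esub> y) = T1 x \<oplus>\<^bsub>M1\<^esub> T1 y"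
    and T2_add: "\<And>x y. \<lbrakk>x \<in> carrier M; y \<in> carrier M\<rbrakk> \<Longrightarrow> T2 (x \<oplus>\<^bsub>M\<^esub> y) = T2 x \<oplus>\<^bsub>M2\<^esub> T2 y"
    and T1_smult: "\<And>a x. x \<in> carrier M \<Longrightarrow> T1 (a \<odot>\<^bsub>M\<^esub> x) = a \<odot>\<^bsub>M1\<^esub> T1 x"
    and T2_smult: "\<And>a x. x \<in> carrier M \<Longrightarrow> T2 (a \<odot>\<^bsub>M\<^esub> x) = a \<odot>\<^bsub>M2\<^esub> T2 x"
    and onto: "\<And>y z. \<lbrakk>y \<in> carrier M1; z \<in> carrier M2\<rbrakk> \<Longrightarrow> \<exists>x\<in>carrier M. T1 x = y \<and> T2 x = z"
    and preimage: "\<And>x. x \<in> carrier M \<Longrightarrow> x \<in> N \<longleftrightarrow> T1 x \<in> N1 \<and> T2 x \<in> N2"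
  shows "isomorphic_spaces (quotient_space M N)
           (direct_sum (quotient_space M1 N1) (quotient_space M2 N2))"
proof -
  interpret M: complex_quotient N M by fact
  interpret M1: complex_quotient N1 M1 by fact
  interpret M2: complex_quotient N2 M2 by fact
  interpret T1: abelian_group_hom M M1 T1
    using T1_closed T1_add M.a_comm_group M1.a_comm_group
    by (intro abelian_group_homI M.abelian_group_axioms M1.abelian_group_axioms)
      (simp add: group_hom_def group_hom_axioms_def hom_def comm_group_def)
  interpret T2: abelian_group_hom M M2 T2
    using T2_closed T2_add M.a_comm_group M2.a_comm_group
    by (intro abelian_group_homI M.abelian_group_axioms M2.abelian_group_axioms)
      (simp add: group_hom_def group_hom_axioms_def hom_def comm_group_def)
  have coset_eq: "N +>\<^bsub>M\<^esub> x = N +>\<^bsub>M\<^esub> y \<longleftrightarrow>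
      N1 +>\<^bsub>M1\<^esub> T1 x = N1 +>\<^bsub>M1\<^esub> T1 y \<and> N2 +>\<^bsub>M2\<^esub> T2 x = N2 +>\<^bsub>M2\<^esub> T2 y"
    if "x \<in> carrier M" "y \<in> carrier M" for x y
    using that preimage[of "x \<oplus>\<^bsub>M\<^esub> \<ominus>\<^bsub>M\<^esub> y"]
    by (simp add: M.coset_eq_iff M1.coset_eq_iff M2.coset_eq_iff)
  \<comment> \<open>The unions avoid a choice of representatives: all members of a coset contribute
    the same set.\<close>
  define \<phi> where
    "\<phi> X = (\<Union>x\<in>X. N1 +>\<^bsub>M1\<^esub> T1 x, \<Union>x\<in>X. N2 +>\<^bsub>M2\<^esub> T2 x)" for X
  have \<phi>: "\<phi> (N +>\<^bsub>M\<^esub> x) = (N1 +>\<^bsub>M1\<^esub> T1 x, N2 +>\<^bsub>M2\<^esub> T2 x)" if x: "x \<in> carrier M" for x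
  proof -
    have "N1 +>\<^bsub>M1\<^esub> T1 y = N1 +>\<^bsub>M1\<^esub> T1 x \<and> N2 +>\<^bsub>M2\<^esub> T2 y = N2 +>\<^bsub>M2\<^esub> T2 x"
      if y: "y \<in> N +>\<^bsub>M\<^esub> x" for y
      using coset_eq[OF M.a_elemrcos_carrier[OF x y] x] M.a_repr_independence'[OF y x] by simp
    then show ?thesis
      using M.a_rcos_self[OF x] unfolding \<phi>_def by blast
  qed
  let ?Q = "quotient_space M N"
  let ?S = "direct_sum (quotient_space M1 N1) (quotient_space M2 N2)"
  have inj: "inj_on \<phi> (carrier ?Q)"
    unfolding M.carrier_quotient_space
  proof (rule inj_onI)
    fix X Y
    assume "X \<in> (\<lambda>x. N +>\<^bsub>M\<^esub> x) ` carrier M" "Y \<in> (\<lambda>x. N +>\<^bsub>M\<^esub> x) ` carrier M"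
      and eq: "\<phi> X = \<phi> Y"
    then obtain x y where xy: "x \<in> carrier M" "y \<in> carrier M" "X = N +>\<^bsub>M\<^esub> x" "Y = N +>\<^bsub>M\<^esub> y"
      by blast
    then show "X = Y"
      using eq coset_eq[OF xy(1,2)] by (simp only: \<phi> prod.inject)
  qed
  have image: "\<phi> ` carrier ?Q = carrier ?S"
  proof (intro equalityI subsetI)
    show "Z \<in> carrier ?S" if "Z \<in> \<phi> ` carrier ?Q" for Z
      using that T1_closed T2_closed
      by (auto simp: M.carrier_quotient_space M1.carrier_quotient_space M2.carrier_quotient_space
          direct_sum_def \<phi>)
    show "Z \<in> \<phi> ` carrier ?Q" if Z: "Z \<in> carrier ?S" for Z
    proof -
      obtain y z where yz: "y \<in> carrier M1" "z \<in> carrier M2"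
        "Z = (N1 +>\<^bsub>M1\<^esub> y, N2 +>\<^bsub>M2\<^esub> z)"
        using Z by (auto simp: M1.carrier_quotient_space M2.carrier_quotient_space direct_sum_def)
      obtain x where "x \<in> carrier M" "T1 x = y" "T2 x = z" using onto yz by blast
      then show ?thesis
        using yz(3) by (auto simp: M.carrier_quotient_space \<phi> intro!: image_eqI[of _ _ "N +>\<^bsub>M\<^esub> x"])
    qed
  qed
  have hom_add: "\<phi> (X \<oplus>\<^bsub>?Q\<^esub> Y) = \<phi> X \<oplus>\<^bsub>?S\<^esub> \<phi> Y" if XY: "X \<in> carrier ?Q" "Y \<in> carrier ?Q" for X Y
  proof -
    obtain x y where xy: "x \<in> carrier M" "y \<in> carrier M" "X = N +>\<^bsub>M\<^esub> x" "Y = N +>\<^bsub>M\<^esub> y"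
      using XY by (auto simp: M.carrier_quotient_space)
    have "\<phi> X \<oplus>\<^bsub>?S\<^esub> \<phi> Y = (N1 +>\<^bsub>M1\<^esub> (T1 x \<oplus>\<^bsub>M1\<^esub> T1 y), N2 +>\<^bsub>M2\<^esub> (T2 x \<oplus>\<^bsub>M2\<^esub> T2 y))"
      using xy T1_closed T2_closed
      by (simp add: \<phi> direct_sum_def M1.add_quotient_space M2.add_quotient_space)
    then show ?thesis
      using xy by (simp add: \<phi> M.add_quotient_space)
  qed
  have hom_smult: "\<phi> (a \<odot>\<^bsub>?Q\<^esub> X) = a \<odot>\<^bsub>?S\<^esub> \<phi> X" if X: "X \<in> carrier ?Q" for a X
  proof -
    obtain x where x: "x \<in> carrier M" "X = N +>\<^bsub>M\<^esub> x"
      using X by (auto simp: M.carrier_quotient_space)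
    have "a \<odot>\<^bsub>?S\<^esub> \<phi> X = (N1 +>\<^bsub>M1\<^esub> (a \<odot>\<^bsub>M1\<^esub> T1 x), N2 +>\<^bsub>M2\<^esub> (a \<odot>\<^bsub>M2\<^esub> T2 x))"
      using x T1_closed T2_closed
      by (simp add: \<phi> direct_sum_def M1.smult_quotient_space M2.smult_quotient_space)
    then show ?thesis
      using x by (simp add: \<phi> M.smult_quotient_space M.smult_closed T1_smult T2_smult)
  qed
  show ?thesis
    unfolding isomorphic_spaces_def bij_betw_def
    by (intro exI[of _ \<phi>] conjI ballI allI inj image hom_add hom_smult)
qed

section \<open>Cocycles of degree one modulo closed coboundaries\<close>

abbreviation cocycle_space ::
    "('g::topological_group_add \<Rightarrow> 'v::complex_normed_vector \<Rightarrow> 'v) \<Rightarrow> 'v set \<Rightarrow>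
     (complex, (nat \<Rightarrow> 'g) \<Rightarrow> 'v) module"
  where "cocycle_space \<rho> V \<equiv> (cochain_space \<rho> V 1)\<lparr>carrier := cocycles \<rho> V 1\<rparr>"

lemma homogenize_add: "homogenize b \<oplus>\<^bsub>cocycle_space \<rho> V\<^esub> homogenize c = homogenize (\<lambda>g. b g + c g)"
  by (rule ext) (simp add: homogenize_def restrict_def numeral_2_eq_2)

lemma homogenize_scaleC:
  "a \<odot>\<^bsub>cocycle_space \<rho> V\<^esub> homogenize b = homogenize (\<lambda>g. a *\<^sub>C (b g :: 'v::complex_normed_vector))"
proof -
  have "a *\<^sub>C (x - y) = a *\<^sub>C x - a *\<^sub>C (y :: 'v)" for x y
    by (metis add_diff_cancel_right' diff_add_cancel scaleC_add_right)
  then show ?thesis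
    by (intro ext) (simp add: homogenize_def restrict_def numeral_2_eq_2)
qed

lemma homogenize_zero: "\<zero>\<^bsub>cocycle_space \<rho> V\<^esub> = homogenize (\<lambda>g. 0)"
  by (rule ext) (simp add: homogenize_def restrict_def numeral_2_eq_2)

lemma scaleC_minus1: "(-1) *\<^sub>C x = - (x :: 'v::complex_normed_vector)"
  using scaleC_complex_of_real[of "-1" x] by simp

context invariant_subspace
begin

lemma crossed_homs_add:
  assumes "b \<in> crossed_homs \<rho> M" "c \<in> crossed_homs \<rho> M"
  shows "(\<lambda>g. b g + c g) \<in> crossed_homs \<rho> M"
  using crossed_homD[OF assms(1)] crossed_homD[OF assms(2)]
  by (simp add: crossed_homs_def image_subset_iff M_add add continuous_on_add algebra_simps)

lemma scaleC_continuous_on: "continuous_on S f \<Longrightarrow> continuous_on S (\<lambda>x. a *\<^sub>C (f x :: 'h))"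
proof -
  have "bounded_linear (\<lambda>x::'h. a *\<^sub>C x)"
    by (rule bounded_linear_intro[where K = "cmod a"])
      (simp_all add: scaleC_add_right norm_scaleC scaleC_scaleC mult.commute
        flip: scaleC_complex_of_real)
  then show "continuous_on S f \<Longrightarrow> continuous_on S (\<lambda>x. a *\<^sub>C (f x :: 'h))"
    by (rule bounded_linear.continuous_on)
qed

lemma crossed_homs_scaleC:
  assumes "b \<in> crossed_homs \<rho> M"
  shows "(\<lambda>g. a *\<^sub>C b g) \<in> crossed_homs \<rho> M"
  using crossed_homD[OF assms]
  by (simp add: crossed_homs_def image_subset_iff M_scaleC scaleC scaleC_add_right
      scaleC_continuous_on)

lemma crossed_homs_zero: "(\<lambda>g. 0) \<in> crossed_homs \<rho> M"
  by (auto simp: crossed_homs_def M_zero)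

lemma approx_principal_add:
  assumes "approx_principal \<rho> M b" "approx_principal \<rho> M c"
  shows "approx_principal \<rho> M (\<lambda>g. b g + c g)"
  unfolding approx_principal_def
proof (intro allI impI)
  fix K :: "'g set" and e :: real
  assume "compact K \<and> 0 < e"
  then have K: "compact K \<and> e / 2 > 0" by simp
  obtain v w where v: "v \<in> M" "\<forall>g\<in>K. norm (b g - (\<rho> g v - v)) < e / 2"
    and w: "w \<in> M" "\<forall>g\<in>K. norm (c g - (\<rho> g w - w)) < e / 2"
    using assms K unfolding approx_principal_def by meson
  have "norm (b g + c g - (\<rho> g (v + w) - (v + w))) < e" if "g \<in> K" for g
  proof -
    have "b g + c g - (\<rho> g (v + w) - (v + w)) = (b g - (\<rho> g v - v)) + (c g - (\<rho> g w - w))"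
      by (simp add: add)
    also have "norm \<dots> < e / 2 + e / 2"
      using v w that by (intro norm_add_less) auto
    finally show ?thesis by simp
  qed
  then show "\<exists>v\<in>M. \<forall>g\<in>K. norm (b g + c g - (\<rho> g v - v)) < e"
    using M_add v w by blast
qed

lemma approx_principal_scaleC:
  assumes "approx_principal \<rho> M b"
  shows "approx_principal \<rho> M (\<lambda>g. a *\<^sub>C b g)"
  unfolding approx_principal_def
proof (intro allI impI)
  fix K :: "'g set" and e :: real
  assume Ke: "compact K \<and> 0 < e"
  \<comment> \<open>Adding one keeps the divisor positive when \<open>a\<close> is zero.\<close>
  define r where "r = cmod a + 1"
  have r: "r > 0" "cmod a < r" by (simp_all add: r_def add_nonneg_pos)
  have "compact K \<and> e / r > 0" using Ke r by simp
  then obtain v where v: "v \<in> M" "\<forall>g\<in>K. norm (b g - (\<rho> g v - v)) < e / r"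
    using assms unfolding approx_principal_def by meson
  have diff_scaleC: "a *\<^sub>C (x - y) = a *\<^sub>C x - a *\<^sub>C y" for x y :: 'h
    by (metis add_diff_cancel_right' diff_add_cancel scaleC_add_right)
  have "norm (a *\<^sub>C b g - (\<rho> g (a *\<^sub>C v) - a *\<^sub>C v)) < e" if "g \<in> K" for g
  proof -
    have "norm (a *\<^sub>C b g - (\<rho> g (a *\<^sub>C v) - a *\<^sub>C v)) = cmod a * norm (b g - (\<rho> g v - v))"
      by (simp add: scaleC diff_scaleC flip: norm_scaleC)
    also have "\<dots> \<le> r * norm (b g - (\<rho> g v - v))"
      using r by (intro mult_right_mono) auto
    also have "\<dots> < r * (e / r)"
      using r v that by (intro mult_strict_left_mono) auto
    finally show ?thesis using r by simp
  qed
  then show "\<exists>v\<in>M. \<forall>g\<in>K. norm (a *\<^sub>C b g - (\<rho> g v - v)) < e"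
    using M_scaleC v(1) by blast
qed

lemma approx_principal_zero: "approx_principal \<rho> M (\<lambda>g. 0)"
  unfolding approx_principal_def by (auto intro!: bexI[of _ 0] simp: M_zero)

lemma complex_quotient_cocycles:
  "complex_quotient (closed_coboundaries \<rho> M 1) (cocycle_space \<rho> M)"
proof -
  let ?Z = "cocycle_space \<rho> M"
  have carrier: "carrier ?Z = homogenize ` crossed_homs \<rho> M"
    unfolding cocycles_1[symmetric] by simp
  have neg: "homogenize (\<lambda>g. (-1) *\<^sub>C b g) \<oplus>\<^bsub>?Z\<^esub> homogenize b = \<zero>\<^bsub>?Z\<^esub>"
    for b :: "'g \<Rightarrow> 'h"
    unfolding homogenize_add homogenize_zero by (simp add: scaleC_minus1)
  interpret Z: abelian_group ?Z
  proof (rule abelian_groupI)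
    show "\<exists>y\<in>carrier ?Z. y \<oplus>\<^bsub>?Z\<^esub> x = \<zero>\<^bsub>?Z\<^esub>" if x: "x \<in> carrier ?Z" for x
    proof -
      obtain b where b: "b \<in> crossed_homs \<rho> M" "x = homogenize b"
        using x unfolding carrier by blast
      have neg_mem: "homogenize (\<lambda>g. (-1) *\<^sub>C b g) \<in> carrier ?Z"
        unfolding carrier by (intro imageI crossed_homs_scaleC b(1))
      show ?thesis
        using neg[of b] unfolding b(2) by (rule bexI[OF _ neg_mem])
    qed
  qed (auto simp only: carrier homogenize_add homogenize_zero crossed_homs_add crossed_homs_zero
      add.assoc add.commute add.left_commute add_0 intro!: imageI)
  have sub: "closed_coboundaries \<rho> M 1 \<subseteq> carrier ?Z"
    unfolding carrier closed_coboundaries_1 by blast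
  have sub_add: "x \<oplus>\<^bsub>?Z\<^esub> y \<in> closed_coboundaries \<rho> M 1"
    if xy: "x \<in> closed_coboundaries \<rho> M 1" "y \<in> closed_coboundaries \<rho> M 1" for x y
  proof -
    obtain b c where b: "b \<in> crossed_homs \<rho> M" "approx_principal \<rho> M b" "x = homogenize b"
      and c: "c \<in> crossed_homs \<rho> M" "approx_principal \<rho> M c" "y = homogenize c"
      using xy unfolding closed_coboundaries_1 by blast
    show ?thesis
      unfolding closed_coboundaries_1 b(3) c(3) homogenize_add
      using crossed_homs_add[OF b(1) c(1)] approx_principal_add[OF b(2) c(2)] by (intro imageI) simp
  qed
  have sub_smult: "a \<odot>\<^bsub>?Z\<^esub> x \<in> closed_coboundaries \<rho> M 1"
    if x: "x \<in> closed_coboundaries \<rho> M 1" for a x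
  proof -
    obtain b where b: "b \<in> crossed_homs \<rho> M" "approx_principal \<rho> M b" "x = homogenize b"
      using x unfolding closed_coboundaries_1 by blast
    show ?thesis
      unfolding closed_coboundaries_1 b(3) homogenize_scaleC
      using crossed_homs_scaleC[OF b(1)] approx_principal_scaleC[OF b(2)] by (intro imageI) simp
  qed
  \<comment> \<open>With negatives expressed as scalar multiples, \<open>sub_smult\<close> also
    yields closure under inverses.\<close>
  have a_inv: "\<ominus>\<^bsub>?Z\<^esub> x = (-1) \<odot>\<^bsub>?Z\<^esub> x" if x: "x \<in> carrier ?Z" for x
  proof -
    obtain b where b: "b \<in> crossed_homs \<rho> M" "x = homogenize b"
      using x unfolding carrier by blast
    have "(-1) \<odot>\<^bsub>?Z\<^esub> x \<in> carrier ?Z"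
      unfolding carrier b(2) homogenize_scaleC by (intro imageI crossed_homs_scaleC b(1))
    then show ?thesis
      using x neg[of b] unfolding b(2) homogenize_scaleC by (intro Z.minus_equality) auto
  qed
  have zero: "\<zero>\<^bsub>?Z\<^esub> \<in> closed_coboundaries \<rho> M 1"
    unfolding closed_coboundaries_1 homogenize_zero
    by (intro imageI CollectI conjI crossed_homs_zero approx_principal_zero)
  have "subgroup (closed_coboundaries \<rho> M 1) (add_monoid ?Z)"
  proof (rule group.subgroupI[OF Z.a_group])
    show "inv\<^bsub>add_monoid ?Z\<^esub> x \<in> closed_coboundaries \<rho> M 1"
      if "x \<in> closed_coboundaries \<rho> M 1" for x
      using sub_smult[OF that] a_inv[of x] sub that by (auto simp: a_inv_def)
  qed (use sub sub_add zero in \<open>auto simp: subset_iff\<close>)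
  then have "abelian_subgroup (closed_coboundaries \<rho> M 1) ?Z"
    by (intro abelian_subgroupI3 additive_subgroupI Z.abelian_group_axioms)
  then show ?thesis
  proof (rule complex_quotient.intro, unfold_locales)
    show "a \<odot>\<^bsub>?Z\<^esub> x \<in> carrier ?Z" if "x \<in> carrier ?Z" for a x
      using that unfolding carrier
      by (auto simp only: homogenize_scaleC intro!: imageI crossed_homs_scaleC)
    show "a \<odot>\<^bsub>?Z\<^esub> (x \<oplus>\<^bsub>?Z\<^esub> y) = a \<odot>\<^bsub>?Z\<^esub> x \<oplus>\<^bsub>?Z\<^esub> a \<odot>\<^bsub>?Z\<^esub> y"
      if "x \<in> carrier ?Z" "y \<in> carrier ?Z" for a x y
      using that unfolding carrier
      by (auto simp only: homogenize_scaleC homogenize_add scaleC_add_right)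
  qed (rule sub_smult)
qed

lemma crossed_hom_zero [simp]:
  assumes "b \<in> crossed_homs \<rho> V"
  shows "b 0 = 0"
  using crossed_homD(3)[OF assms, of 0 0] by simp

text \<open>Crossed homomorphisms vanish at \<open>0\<close>, so evaluation at
  \<open>pair_args 0 g\<close> returns \<open>b g\<close>.\<close>

lemma homogenize_inject:
  assumes "b \<in> crossed_homs \<rho> V" "c \<in> crossed_homs \<rho> V"
  shows "homogenize b = homogenize c \<longleftrightarrow> b = c"
proof
  assume eq: "homogenize b = homogenize c"
  have "b g = c g" for g
    using fun_cong[OF eq, of "pair_args 0 g"] assms by simp
  then show "b = c" by blast
qed simp

lemma homogenize_mem_closed_coboundaries:
  assumes "b \<in> crossed_homs \<rho> M"
  shows "homogenize b \<in> closed_coboundaries \<rho> M 1 \<longleftrightarrow> approx_principal \<rho> M b"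
proof
  assume "homogenize b \<in> closed_coboundaries \<rho> M 1"
  then obtain c where "c \<in> crossed_homs \<rho> M" "approx_principal \<rho> M c" "homogenize b = homogenize c"
    unfolding closed_coboundaries_1 by blast
  then show "approx_principal \<rho> M b"
    using homogenize_inject[OF assms] by simp
next
  assume "approx_principal \<rho> M b"
  then show "homogenize b \<in> closed_coboundaries \<rho> M 1"
    using assms unfolding closed_coboundaries_1 by blast
qed

end

section \<open>The product formula\<close>

lemma reduced_cohomology_product:
  fixes \<rho> :: "'g1::topological_group_add \<times> 'g2::topological_group_add \<Rightarrow>
                'h::complex_hilbert_space \<Rightarrow> 'h"
  assumes urep: "unitary_rep \<rho>"
    and \<rho>1_def: "\<rho>1 = (\<lambda>g. \<rho> (g, 0))" and \<rho>2_def: "\<rho>2 = (\<lambda>g. \<rho> (0, g))"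
  shows "isomorphic_spaces (reduced_cohomology \<rho> UNIV 1)
           (direct_sum (reduced_cohomology \<rho>1 (fixed_vectors \<rho>2) 1)
                       (reduced_cohomology \<rho>2 (fixed_vectors \<rho>1) 1))"
proof -
  interpret unitary_rep \<rho> by fact
  interpret U: invariant_subspace \<rho> UNIV by unfold_locales auto
  interpret S1: invariant_subspace \<rho> "fixed_vectors \<rho>1"
    unfolding \<rho>1_def by (rule invariant_subspace_fixed_vectors_factors[OF urep])
  interpret S2: invariant_subspace \<rho> "fixed_vectors \<rho>2"
    unfolding \<rho>2_def by (rule invariant_subspace_fixed_vectors_factors[OF urep])
  have "unitary_rep \<rho>1" "unitary_rep \<rho>2"
    unfolding \<rho>1_def \<rho>2_def by (rule unitary_rep_product_factors[OF urep])+
  then interpret I1: invariant_subspace \<rho>1 "fixed_vectors \<rho>2" + I2: invariant_subspace \<rho>2 "fixed_vectors \<rho>1"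
    using S1.M_closed S1.M_zero S1.M_add S1.M_scaleC S1.M_invariant
      S2.M_closed S2.M_zero S2.M_add S2.M_scaleC S2.M_invariant
    by (simp_all add: invariant_subspace_def invariant_subspace_axioms_def \<rho>1_def \<rho>2_def)
  define R1 where "R1 b = (\<lambda>g. S2.proj (b (g, 0)))" for b :: "'g1 \<times> 'g2 \<Rightarrow> 'h"
  define R2 where "R2 b = (\<lambda>g. S1.proj (b (0, g)))" for b :: "'g1 \<times> 'g2 \<Rightarrow> 'h"
  \<comment> \<open>Evaluation at \<open>pair_args 0 x\<close> undoes \<open>homogenize\<close>, so
    on cocycles \<open>T1\<close> and \<open>T2\<close> act as \<open>R1\<close> and
    \<open>R2\<close> on crossed homomorphisms.\<close>
  define T1 where "T1 c = homogenize (R1 (\<lambda>x. c (pair_args 0 x)))" for c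
  define T2 where "T2 c = homogenize (R2 (\<lambda>x. c (pair_args 0 x)))" for c
  have T1: "T1 (homogenize b) = homogenize (R1 b)" and T2: "T2 (homogenize b) = homogenize (R2 b)"
    if "b \<in> crossed_homs \<rho> UNIV" for b
    using that by (simp_all add: T1_def T2_def)
  have R1: "R1 b \<in> crossed_homs \<rho>1 (fixed_vectors \<rho>2)"
    and R2: "R2 b \<in> crossed_homs \<rho>2 (fixed_vectors \<rho>1)"
    if b: "b \<in> crossed_homs \<rho> UNIV" for b
    using crossed_hom_compose[OF S2.proj_crossed_hom[OF b], of "\<lambda>g. (g, 0)"]
      crossed_hom_compose[OF S1.proj_crossed_hom[OF b], of "\<lambda>g. (0, g)"]
    by (simp_all add: R1_def R2_def \<rho>1_def \<rho>2_def continuous_on_Pair)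
  have carrier: "carrier (cocycle_space \<rho> UNIV) = homogenize ` crossed_homs \<rho> UNIV"
    "carrier (cocycle_space \<rho>1 (fixed_vectors \<rho>2)) = homogenize ` crossed_homs \<rho>1 (fixed_vectors \<rho>2)"
    "carrier (cocycle_space \<rho>2 (fixed_vectors \<rho>1)) = homogenize ` crossed_homs \<rho>2 (fixed_vectors \<rho>1)"
    unfolding U.cocycles_1[symmetric] I1.cocycles_1[symmetric] I2.cocycles_1[symmetric]
    by simp_all
  have R_add: "R1 (\<lambda>x. b x + c x) = (\<lambda>g. R1 b g + R1 c g)"
    "R2 (\<lambda>x. b x + c x) = (\<lambda>g. R2 b g + R2 c g)" for b c
    by (simp_all add: R1_def R2_def S1.proj_add S2.proj_add)
  have R_scaleC: "R1 (\<lambda>x. a *\<^sub>C b x) = (\<lambda>g. a *\<^sub>C R1 b g)"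
    "R2 (\<lambda>x. a *\<^sub>C b x) = (\<lambda>g. a *\<^sub>C R2 b g)" for a b
    by (simp_all add: R1_def R2_def S1.proj_scaleC S2.proj_scaleC)
  show ?thesis
    unfolding reduced_cohomology_def
  proof (rule quotient_isomorphic_direct_sum[where ?T1.0 = T1 and ?T2.0 = T2,
        OF U.complex_quotient_cocycles I1.complex_quotient_cocycles I2.complex_quotient_cocycles])
    let ?Z = "cocycle_space \<rho> UNIV"
    show "T1 x \<in> carrier (cocycle_space \<rho>1 (fixed_vectors \<rho>2))" if "x \<in> carrier ?Z" for x
      using that R1 T1 unfolding carrier by auto
    show "T2 x \<in> carrier (cocycle_space \<rho>2 (fixed_vectors \<rho>1))" if "x \<in> carrier ?Z" for x
      using that R2 T2 unfolding carrier by auto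
    show "T1 (x \<oplus>\<^bsub>?Z\<^esub> y) = T1 x \<oplus>\<^bsub>cocycle_space \<rho>1 (fixed_vectors \<rho>2)\<^esub> T1 y"
      if "x \<in> carrier ?Z" "y \<in> carrier ?Z" for x y
      using that unfolding carrier
      by (auto simp only: homogenize_add T1 R_add U.crossed_homs_add)
    show "T2 (x \<oplus>\<^bsub>?Z\<^esub> y) = T2 x \<oplus>\<^bsub>cocycle_space \<rho>2 (fixed_vectors \<rho>1)\<^esub> T2 y"
      if "x \<in> carrier ?Z" "y \<in> carrier ?Z" for x y
      using that unfolding carrier
      by (auto simp only: homogenize_add T2 R_add U.crossed_homs_add)
    show "T1 (a \<odot>\<^bsub>?Z\<^esub> x) = a \<odot>\<^bsub>cocycle_space \<rho>1 (fixed_vectors \<rho>2)\<^esub> T1 x"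
      if "x \<in> carrier ?Z" for a x
      using that unfolding carrier
      by (auto simp only: homogenize_scaleC T1 R_scaleC U.crossed_homs_scaleC)
    show "T2 (a \<odot>\<^bsub>?Z\<^esub> x) = a \<odot>\<^bsub>cocycle_space \<rho>2 (fixed_vectors \<rho>1)\<^esub> T2 x"
      if "x \<in> carrier ?Z" for a x
      using that unfolding carrier
      by (auto simp only: homogenize_scaleC T2 R_scaleC U.crossed_homs_scaleC)
    show "x \<in> closed_coboundaries \<rho> UNIV 1 \<longleftrightarrow>
        T1 x \<in> closed_coboundaries \<rho>1 (fixed_vectors \<rho>2) 1 \<and>
        T2 x \<in> closed_coboundaries \<rho>2 (fixed_vectors \<rho>1) 1"
      if x: "x \<in> carrier ?Z" for x
    proof -
      obtain b where b: "b \<in> crossed_homs \<rho> UNIV" "x = homogenize b"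
        using x unfolding carrier by blast
      show ?thesis
        unfolding b(2) T1[OF b(1)] T2[OF b(1)] U.homogenize_mem_closed_coboundaries[OF b(1)]
          I1.homogenize_mem_closed_coboundaries[OF R1[OF b(1)]]
          I2.homogenize_mem_closed_coboundaries[OF R2[OF b(1)]]
        using product_approx_principal_iff[OF urep b(1)]
        by (simp only: R1_def R2_def \<rho>1_def \<rho>2_def)
    qed
    show "\<exists>x\<in>carrier ?Z. T1 x = y \<and> T2 x = z"
      if yz: "y \<in> carrier (cocycle_space \<rho>1 (fixed_vectors \<rho>2))"
        "z \<in> carrier (cocycle_space \<rho>2 (fixed_vectors \<rho>1))" for y z
    proof -
      obtain b1 b2 where b1: "b1 \<in> crossed_homs \<rho>1 (fixed_vectors \<rho>2)" "y = homogenize b1"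
        and b2: "b2 \<in> crossed_homs \<rho>2 (fixed_vectors \<rho>1)" "z = homogenize b2"
        using yz unfolding carrier by blast
      define b where "b x = b1 (fst x) + b2 (snd x)" for x
      have b: "b \<in> crossed_homs \<rho> UNIV"
        using product_crossed_hom[OF urep] b1 b2 by (simp add: b_def[abs_def] \<rho>1_def \<rho>2_def)
      \<comment> \<open>On \<open>(g, 0)\<close> the summand \<open>b2\<close> vanishes, and
        \<open>b1 g\<close> already lies in the space projected to; likewise for the other
        factor.\<close>
      have "R1 b = b1" "R2 b = b2"
        using crossed_homD(2)[OF b1(1)] crossed_homD(2)[OF b2(1)]
          I1.crossed_hom_zero[OF b1(1)] I2.crossed_hom_zero[OF b2(1)]
        by (simp_all add: R1_def R2_def b_def S1.proj_fix S2.proj_fix)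
      then show ?thesis
        using b T1 T2 b1 b2 unfolding carrier by auto
    qed
  qed
qed

text \<open>When both fixed spaces are zero, every crossed homomorphism is orthogonal to them, so
  the orthogonal case applies directly, without the isomorphism.\<close>

lemma almost_fixes_point_product:
  fixes \<rho> :: "'g1::topological_group_add \<times> 'g2::topological_group_add \<Rightarrow>
                'h::complex_hilbert_space \<Rightarrow> 'h"
  assumes urep: "unitary_rep \<rho>"
    and fixed: "fixed_vectors (\<lambda>g. \<rho> (g, 0)) = {0}" "fixed_vectors (\<lambda>g. \<rho> (0, g)) = {0}"
    and \<alpha>: "affine_isometric_action \<rho> \<alpha>" "continuous_action \<alpha>"
  shows "almost_fixes_point \<alpha>"
proof -
  interpret unitary_rep \<rho> by fact
  obtain b where b: "\<And>g v. \<alpha> g v = \<rho> g v + b g"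
    using \<alpha>(1) unfolding affine_isometric_action_def by blast
  then have b_def: "b g = \<alpha> g 0" for g by simp
  have "b (g + h) = b g + \<rho> g (b h)" for g h
  proof -
    have "\<alpha> (g + h) = \<alpha> g \<circ> \<alpha> h"
      using \<alpha>(1) unfolding affine_isometric_action_def by blast
    then have "\<alpha> (g + h) 0 = \<alpha> g (\<alpha> h 0)" by simp
    then show ?thesis by (simp add: b add.commute)
  qed
  moreover have "continuous_on UNIV b"
    using \<alpha>(2) by (simp add: continuous_action_def b_def[abs_def])
  ultimately have "b \<in> crossed_homs \<rho> UNIV" by (simp add: crossed_homs_def del: split_paired_All)
  then have approx: "approx_principal \<rho> UNIV b"
    using fixed by (intro product_approx_principal_if_orthogonal[OF urep]) auto
  show ?thesis
    unfolding almost_fixes_point_def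
  proof (intro allI impI)
    fix K :: "('g1 \<times> 'g2) set" and e :: real
    assume "compact K \<and> 0 < e"
    then obtain v where "\<forall>g\<in>K. norm (b g - (\<rho> g v - v)) < e"
      using approx unfolding approx_principal_def by meson
    then show "\<exists>v. \<forall>g\<in>K. norm (\<alpha> g v - v) < e"
      by (intro exI[of _ "- v"]) (simp add: b neg algebra_simps)
  qed
qed

theorem corollary3:
  fixes \<rho> :: "'g1::topological_group_add \<times> 'g2::topological_group_add \<Rightarrow>
                'h::complex_hilbert_space \<Rightarrow> 'h"
  defines "\<rho>1 \<equiv> \<lambda>g. \<rho> (g, 0)" and "\<rho>2 \<equiv> \<lambda>g. \<rho> (0, g)"
  assumes "continuous_unitary_rep \<rho>"
  shows "isomorphic_spaces (reduced_cohomology \<rho> UNIV 1)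
           (direct_sum (reduced_cohomology \<rho>1 (fixed_vectors \<rho>2) 1)
                       (reduced_cohomology \<rho>2 (fixed_vectors \<rho>1) 1)) \<and>
         (fixed_vectors \<rho>1 = {0} \<and> fixed_vectors \<rho>2 = {0} \<longrightarrow>
           (\<forall>\<alpha>. affine_isometric_action \<rho> \<alpha> \<and> continuous_action \<alpha> \<longrightarrow> almost_fixes_point \<alpha>))"
proof (intro conjI impI allI)
  have rep: "unitary_rep \<rho>" using assms(3) by (rule unitary_rep.intro)
  show "isomorphic_spaces (reduced_cohomology \<rho> UNIV 1)
      (direct_sum (reduced_cohomology \<rho>1 (fixed_vectors \<rho>2) 1)
                  (reduced_cohomology \<rho>2 (fixed_vectors \<rho>1) 1))"
    by (rule reduced_cohomology_product[OF rep \<rho>1_def[THEN meta_eq_to_obj_eq]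
          \<rho>2_def[THEN meta_eq_to_obj_eq]])
  show "almost_fixes_point \<alpha>"
    if "fixed_vectors \<rho>1 = {0} \<and> fixed_vectors \<rho>2 = {0}"
      and "affine_isometric_action \<rho> \<alpha> \<and> continuous_action \<alpha>" for \<alpha>
    by (rule almost_fixes_point_product[OF rep])
      (use that in \<open>simp_all only: \<rho>1_def \<rho>2_def\<close>)
qed

end
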